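(* Let $n\in\mathbb{N}$ and let $E\subset\mathbb{R}^n$ be a weakly porous set. Let $\alpha\in\mathbb{R}$ and define $w(x)=\operatorname{dist}(x,E)^{-\alpha}$ for every $x\in\mathbb{R}^n$. Then: (i) $w\in A_1$ if and only if $0\le\alpha<\operatorname{Mu}(E)$. (ii) For every $1<p<\infty$: $w\in A_p$ if and only if $(1-p)\operatorname{Mu}(E)<\alpha<\operatorname{Mu}(E)$.
   Context: $\mathbb{N}=\{1,2,\dots\}$; $|\cdot|$ is $n$-dimensional Lebesgue measure; $\operatorname{dist}(x,E)$ is the Euclidean distance; $B(x,r)$ is the open Euclidean ball. Conventions: $0^0=1$; for $\alpha>0$, $\operatorname{dist}(x,E)^{-\alpha}=+\infty$ where $\operatorname{dist}(x,E)=0$. Cubes: a cube is a half-open set $Q=[a_1,b_1)\times\cdots\times[a_n,b_n)$ with all sides of equal length $\ell(Q)=b_i-a_i>0$. For a cube $P$ and $j\ge 0$, $\mathcal{D}_j(P)$ is the collection of the $2^{jn}$ pairwise disjoint half-open cubes of side length $2^{-j}\ell(P)$ whose union is $P$, and $\mathcal{D}(P)=\bigcup_{j\ge0}\mathcal{D}_j(P)$. Weak porosity: let $E\subset\mathbb{R}^n$ be nonempty. A cube $Q\in\mathcal{D}(P)$ is $E$-free if $E\cap Q=\emptyset$. $\mathcal{M}(P)\in\mathcal{D}(P)$ denotes a (fixed choice of a) largest $E$-free dyadic subcube of $P$. $E$ is weakly porous if there are constants $0<c,\delta<1$ such that for every cube $P\subset\mathbb{R}^n$ there exist $N\in\mathbb{N}$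 and pairwise disjoint $E$-free cubes $Q_1,\dots,Q_N\in\mathcal{D}(P)$ with $|Q_k|\ge\delta|\mathcal{M}(P)|$ for all $k$ and $\sum_{k=1}^N|Q_k|\ge c|P|$ (in particular, every cube $P$ is required to have an $E$-free dyadic subcube). Muckenhoupt exponent: for a ball $B(x,r)$, $h_E(B(x,r))$ is the supremum of all $t>0$ such that $B(y,t)\subset B(x,r)\setminus E$ for some $y\in B(x,r)$, and $h_E(B(x,r))=0$ if there is no such $t$. Let $E_r=\{y\in\mathbb{R}^n:\operatorname{dist}(y,E)<r\}$. If $h_E(B(x,R))>0$ for every $x\in E$ and $R>0$, then $\operatorname{Mu}(E)$ is the supremum of the numbers $\alpha\in\mathbb{R}$ for which there is a constant $C$ such that $$\frac{|E_r\cap B(x,R)|}{|B(x,R)|}\le C\Bigl(\frac{h_E(B(x,R))}{r}\Bigr)^{-\alpha}$$ for every $x\in E$ and $0<r<h_E(B(x,R))\le R$. If $h_E(B(x,R))=0$ for some $x\in E$ and $R>0$, then $\operatorname{Mu}(E)=0$. A weight is a locally integrable function $w$ on $\mathbb{R}^n$ with $w>0$ almost everywhere. A weight $w$ is in $A_1$ if there is $C$ with $\frac1{|Q|}\int_Q w\,dx\le C\operatorname{ess\,inf}_{Q}w$ for every cube $Q\subset\mathbb{R}^n$; for $1<p<\infty$ it is in $A_p$ if there is $C$ with $\frac1{|Q|}\int_Q w\,dx\,\bigl(\frac1{|Q|}\int_Q w^{\frac1{1-p}}dx\bigr)^{p-1}\le C$ for every cube $Q\subset\mathbb{R}^n$.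 A function that is not a weight belongs to no $A_p$. *)

theory Defs
  imports "HOL-Analysis.Analysis"
begin

section \<open>Cubes and weak porosity\<close>

definition hcube :: "real ^ 'n \<Rightarrow> real \<Rightarrow> (real ^ 'n) set" where
  "hcube a l = {x. \<forall>i. a $ i \<le> x $ i \<and> x $ i < a $ i + l}"

definition is_cube :: "(real ^ 'n) set \<Rightarrow> bool" where
  "is_cube Q \<longleftrightarrow> (\<exists>a l. 0 < l \<and> Q = hcube a l)"

text \<open>A cube, being nonempty, determines its corner \<open>a\<close> and its side length \<open>l\<close>, so the existential
  quantifiers over \<open>a\<close> and \<open>l\<close> below only name the data of \<open>P\<close>.\<close>

definition dyadic_gen :: "nat \<Rightarrow> (real ^ 'n) set \<Rightarrow> (real ^ 'n) set set" where
  "dyadic_gen j P =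
     {Q. \<exists>a l. \<exists>k :: 'n \<Rightarrow> nat. 0 < l \<and> P = hcube a l \<and> (\<forall>i. k i < 2 ^ j) \<and>
           Q = hcube (\<chi> i. a $ i + real (k i) * (l / 2 ^ j)) (l / 2 ^ j)}"

definition dyadic :: "(real ^ 'n) set \<Rightarrow> (real ^ 'n) set set" where
  "dyadic P = (\<Union>j. dyadic_gen j P)"

definition free_dyadic :: "(real ^ 'n) set \<Rightarrow> (real ^ 'n) set \<Rightarrow> (real ^ 'n) set set" where
  "free_dyadic E P = {Q \<in> dyadic P. E \<inter> Q = {}}"

text \<open>If \<open>P\<close> has a free dyadic subcube, a largest one exists, because side lengths are
  \<open>2\<^sup>-\<^sup>j\<close> times that of \<open>P\<close>. Otherwise the value is unspecified; it is then irrelevant in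
  \<open>weakly_porous\<close>, which fails for lack of free cubes.\<close>

definition max_free :: "(real ^ 'n) set \<Rightarrow> (real ^ 'n) set \<Rightarrow> (real ^ 'n) set" where
  "max_free E P = (SOME Q. Q \<in> free_dyadic E P \<and>
     (\<forall>Q' \<in> free_dyadic E P. measure lebesgue Q' \<le> measure lebesgue Q))"

definition weakly_porous :: "(real ^ 'n) set \<Rightarrow> bool" where
  "weakly_porous E \<longleftrightarrow> E \<noteq> {} \<and>
     (\<exists>c \<delta>. 0 < c \<and> c < 1 \<and> 0 < \<delta> \<and> \<delta> < 1 \<and>
       (\<forall>P. is_cube P \<longrightarrow>
         (\<exists>(N::nat) Q. 1 \<le> N \<and> disjoint_family_on Q {1..N} \<and>
           (\<forall>k\<in>{1..N}. Q k \<in> free_dyadic E P \<and>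
              measure lebesgue (Q k) \<ge> \<delta> * measure lebesgue (max_free E P)) \<and>
           (\<Sum>k=1..N. measure lebesgue (Q k)) \<ge> c * measure lebesgue P)))"

section \<open>The Muckenhoupt exponent\<close>

definition hole :: "(real ^ 'n) set \<Rightarrow> real ^ 'n \<Rightarrow> real \<Rightarrow> real" where
  "hole E x r =
     (let T = {t. 0 < t \<and> (\<exists>y \<in> ball x r. ball y t \<subseteq> ball x r - E)}
      in if T = {} then 0 else Sup T)"

text \<open>\<open>infdist\<close> is the Euclidean distance to a nonempty set; it is only used for nonempty sets.\<close>

definition nbhd :: "(real ^ 'n) set \<Rightarrow> real \<Rightarrow> (real ^ 'n) set" where
  "nbhd E r = {y. infdist y E < r}"

definition Mu_admissible :: "(real ^ 'n) set \<Rightarrow> real \<Rightarrow> bool" where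
  "Mu_admissible E \<alpha> \<longleftrightarrow>
     (\<exists>C::real. \<forall>x\<in>E. \<forall>r R. 0 < r \<and> r < hole E x R \<and> hole E x R \<le> R \<longrightarrow>
        measure lebesgue (nbhd E r \<inter> ball x R) / measure lebesgue (ball x R)
          \<le> C * (hole E x R / r) powr (- \<alpha>))"

text \<open>The supremum is taken in the extended reals, so that no boundedness has to be presupposed.\<close>

definition Mu :: "(real ^ 'n) set \<Rightarrow> ereal" where
  "Mu E = (if \<forall>x\<in>E. \<forall>R>0. 0 < hole E x R
           then (SUP \<alpha>\<in>{\<alpha>. Mu_admissible E \<alpha>}. ereal \<alpha>) else 0)"

section \<open>Muckenhoupt weights\<close>

text \<open>Real powers on \<open>[0,\<infinity>]\<close>: \<open>x\<^sup>0 = 1\<close> for all \<open>x\<close> (in particular \<open>0\<^sup>0 = 1\<close>, whereas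
  \<open>0 powr 0 = 0\<close>), and for \<open>s > 0\<close>: \<open>0\<^sup>s = 0\<close>, \<open>\<infinity>\<^sup>s = \<infinity>\<close>, and \<open>0\<close> to the power \<open>-s\<close> is
  \<open>\<infinity>\<close>, \<open>\<infinity>\<close> to the power \<open>-s\<close> is \<open>0\<close>.\<close>

definition epow :: "ennreal \<Rightarrow> real \<Rightarrow> ennreal" where
  "epow x s =
     (if s = 0 then 1
      else if x = 0 then (if 0 < s then 0 else \<infinity>)
      else if x = \<infinity> then (if 0 < s then \<infinity> else 0)
      else ennreal (enn2real x powr s))"

definition dist_weight :: "(real ^ 'n) set \<Rightarrow> real \<Rightarrow> real ^ 'n \<Rightarrow> ennreal" where
  "dist_weight E \<alpha> x = epow (ennreal (infdist x E)) (- \<alpha>)"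

definition is_weight :: "(real ^ 'n \<Rightarrow> ennreal) \<Rightarrow> bool" where
  "is_weight w \<longleftrightarrow> w \<in> borel_measurable lebesgue \<and>
     (\<forall>K. compact K \<longrightarrow> (\<integral>\<^sup>+x\<in>K. w x \<partial>lebesgue) < \<infinity>) \<and>
     (AE x in lebesgue. 0 < w x)"

definition cube_avg :: "(real ^ 'n) set \<Rightarrow> (real ^ 'n \<Rightarrow> ennreal) \<Rightarrow> ennreal" where
  "cube_avg Q w = (\<integral>\<^sup>+x\<in>Q. w x \<partial>lebesgue) / emeasure lebesgue Q"

definition ess_inf :: "(real ^ 'n) set \<Rightarrow> (real ^ 'n \<Rightarrow> ennreal) \<Rightarrow> ennreal" where
  "ess_inf Q w = Sup {c. AE x in lebesgue. x \<in> Q \<longrightarrow> c \<le> w x}"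

definition A_one :: "(real ^ 'n \<Rightarrow> ennreal) set" where
  "A_one = {w. is_weight w \<and>
     (\<exists>C::real. \<forall>Q. is_cube Q \<longrightarrow> cube_avg Q w \<le> ennreal C * ess_inf Q w)}"

definition A_class :: "real \<Rightarrow> (real ^ 'n \<Rightarrow> ennreal) set" where
  "A_class p = {w. is_weight w \<and>
     (\<exists>C::real. \<forall>Q. is_cube Q \<longrightarrow>
        cube_avg Q w * epow (cube_avg Q (\<lambda>x. epow (w x) (1 / (1 - p)))) (p - 1) \<le> ennreal C)}"

end

theory Submission
  imports Defs
begin

text \<open>Write \<open>d\<close> for the distance to \<open>E\<close> and \<open>n\<close> for the dimension. Everything rests on one
  consequence of weak porosity that no longer mentions dyadic cubes, \<open>weakly_porous_spread\<close>: there
  are \<open>c, \<delta> > 0\<close> such that for every cube \<open>Q\<close> and every \<open>y \<in> Q\<close> the inequality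
  \<open>d x \<ge> \<delta> d y\<close> holds on a part of \<open>Q\<close> of volume at least \<open>c |Q|\<close>. So, up to constants, the
  largest value of \<open>d\<close> on a cube is attained on a fixed proportion of the cube. This gives the
  lower bounds for averages of nonnegative powers of \<open>d\<close>, and it turns both
  the \<open>A\<^sub>1\<close> and the \<open>A\<^sub>p\<close> condition for \<open>d\<close> to the power \<open>-\<alpha>\<close>, \<open>\<alpha> > 0\<close>, into the same
  statement \<open>weight_bound\<close>: the average of \<open>d\<^sup>-\<^sup>\<alpha>\<close> over \<open>Q\<close> is at most \<open>C (d y)\<^sup>-\<^sup>\<alpha>\<close> for all
  \<open>y \<in> Q\<close>. In \<open>A\<^sub>p\<close> the dual weight is \<open>d\<close> to the power \<open>-\<alpha>/(1-p)\<close>, so the theorem reduces to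
  two facts: \<open>Mu E > 0\<close>, and, for \<open>\<alpha> > 0\<close>, \<open>weight_bound\<close> holds exactly if \<open>\<alpha> < Mu E\<close>.

  If \<open>\<alpha> < Mu E\<close>, some exponent above \<open>\<alpha>\<close> is admissible. Summing over the layers where \<open>d\<close> is
  about \<open>h 2\<^sup>-\<^sup>k\<close>, with \<open>h\<close> the hole of a ball centred on \<open>E\<close>, bounds the average of \<open>d\<^sup>-\<^sup>\<alpha>\<close> over
  that ball by a multiple of \<open>h\<^sup>-\<^sup>\<alpha>\<close>. A cube near \<open>E\<close> lies in such a ball, whose hole is at least
  the values of \<open>d\<close> on the cube; on a cube far from \<open>E\<close> the function \<open>d\<close> is almost constant.

  The converse must produce an admissible exponent strictly above \<open>\<alpha>\<close>, a reverse Hoelder type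
  gain. Spread implies that passing to one of the \<open>2\<^sup>n\<close> half cubes loses only a constant factor in
  the maximum of \<open>d\<close> (\<open>doubling\<close>). Hence one can halve a cube until the maximum of \<open>d\<close> is
  comparable to a given \<open>s\<close>; the resulting cubes that meet \<open>d < s\<close> cover it and stay inside
  \<open>d < 2 (1 + n) s\<close>. Bounds for the integral of a function over cubes therefore give a bound for
  its integral over \<open>d < s\<close> by the volume of \<open>d < 2 (1 + n) s\<close> (\<open>local_to_global\<close>). Two choices
  of the function finish the proof. The indicator of a smaller sublevel set shows that sublevel
  volumes decay geometrically, so \<open>Mu E > 0\<close>. For \<open>d\<^sup>-\<^sup>\<alpha>\<close>
  one obtains, with \<open>u\<^sub>k\<close> the volume of \<open>d < s\<^sub>k\<close> times \<open>s\<^sub>k\<^sup>-\<^sup>\<alpha>\<close> along a geometric sequence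
  \<open>s\<^sub>k\<close>, that every tail of the series of the \<open>u\<^sub>k\<close> is bounded by a multiple of the term
  preceding it. Such a sequence decays geometrically, and this is the gain in the exponent.\<close>

section \<open>Cubes\<close>

lemma hcube_borel [measurable]: "hcube a l \<in> sets borel"
proof -
  have "hcube a l = (\<Inter>i\<in>UNIV. {x. a $ i \<le> x $ i} \<inter> {x. x $ i < a $ i + l})"
    by (auto simp: hcube_def)
  also have "\<dots> \<in> sets borel"
    by (intro sets.finite_INT sets.Int borel_closed borel_open closed_Collect_le open_Collect_less
        continuous_intros) auto
  finally show ?thesis .
qed

lemma hcube_lebesgue [measurable]: "hcube a l \<in> sets lebesgue"
  by (simp add: hcube_borel)

lemma emeasure_hcube:
  assumes "0 < l"
  shows "emeasure lebesgue (hcube (a :: real ^ 'n) l) = ennreal (l ^ CARD('n))"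
    and "emeasure lborel (hcube a l) = ennreal (l ^ CARD('n))"
proof -
  have 1: "box a (\<chi> i. a $ i + l) \<subseteq> hcube a l" "hcube a l \<subseteq> cbox a (\<chi> i. a $ i + l)"
    by (auto simp: hcube_def mem_box_cart less_imp_le)
  have ne: "cbox a (\<chi> i. a $ i + l) \<noteq> {}"
    using assms by (auto simp: interval_ne_empty_cart less_imp_le)
  have c: "measure lborel (cbox a (\<chi> i. a $ i + l)) = l ^ CARD('n)"
    using content_cbox_cart[OF ne] by simp
  have e1: "emeasure lborel (cbox a (\<chi> i. a $ i + l)) = ennreal (l ^ CARD('n))"
    using emeasure_eq_ennreal_measure[of lborel "cbox a (\<chi> i. a $ i + l)"] c
    by (simp add: emeasure_lborel_cbox_eq split: if_splits)
  have e2: "emeasure lborel (box a (\<chi> i. a $ i + l)) = ennreal (l ^ CARD('n))"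
    using e1 by (simp add: emeasure_lborel_box_eq emeasure_lborel_cbox_eq inner_simps split: if_splits)
      
  have "emeasure lborel (hcube a l) \<le> ennreal (l ^ CARD('n))"
    unfolding e1[symmetric] by (rule emeasure_mono[OF 1(2)]) simp
  moreover have "ennreal (l ^ CARD('n)) \<le> emeasure lborel (hcube a l)"
    unfolding e2[symmetric] by (rule emeasure_mono[OF 1(1)]) simp
  ultimately have "emeasure lborel (hcube a l) = ennreal (l ^ CARD('n))" by (rule antisym)
  then show "emeasure lborel (hcube a l) = ennreal (l ^ CARD('n))"
    "emeasure lebesgue (hcube a l) = ennreal (l ^ CARD('n))" by (simp_all add: hcube_borel)
qed

lemma measure_hcube:
  assumes "0 < l"
  shows "measure lebesgue (hcube (a :: real ^ 'n) l) = l ^ CARD('n)"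
    and "measure lborel (hcube a l) = l ^ CARD('n)"
  using assms by (simp_all only: measure_def emeasure_hcube) simp_all

lemma hcube_lmeasurable: "0 < l \<Longrightarrow> hcube a l \<in> lmeasurable"
  using emeasure_hcube[of l a] by (intro fmeasurableI hcube_lebesgue) simp

lemma dist_hcube:
  fixes x y a :: "real ^ 'n"
  assumes "x \<in> hcube a l" "y \<in> hcube a l"
  shows "dist x y \<le> real CARD('n) * l"
proof -
  have "norm (x - y) \<le> (\<Sum>i\<in>UNIV. \<bar>(x - y) $ i\<bar>)" by (rule norm_le_l1_cart)
  also have "\<dots> \<le> (\<Sum>i\<in>(UNIV::'n set). l)"
  proof (rule sum_mono)
    fix i
    have "a $ i \<le> x $ i" "x $ i < a $ i + l" "a $ i \<le> y $ i" "y $ i < a $ i + l"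
      using assms by (auto simp: hcube_def)
    then show "\<bar>(x - y) $ i\<bar> \<le> l" by simp
  qed
  finally show ?thesis by (simp add: dist_norm)
qed

lemma infdist_hcube:
  fixes x y a :: "real ^ 'n"
  assumes "x \<in> hcube a l" "y \<in> hcube a l"
  shows "infdist x E \<le> infdist y E + real CARD('n) * l"
  using infdist_triangle[of x E y] dist_hcube[OF assms] by linarith

lemma hcube_corner: "0 < l \<Longrightarrow> a \<in> hcube a l"
  by (auto simp: hcube_def)

lemma hcube_inject:
  assumes "hcube a l = hcube b m" "0 < l" "0 < m"
  shows "a = b \<and> l = m"
proof -
  have "a \<in> hcube b m"
    using hcube_corner[OF assms(2), of a] unfolding assms(1) .
  moreover have "b \<in> hcube a l"
    using hcube_corner[OF assms(3), of b] unfolding assms(1)[symmetric] .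
  ultimately have ab: "a = b" by (auto simp: hcube_def vec_eq_iff intro: antisym)
  have "l ^ CARD('a) = m ^ CARD('a)"
    using arg_cong[OF assms(1), of "measure lebesgue"]
    by (simp only: measure_hcube[OF assms(2)] measure_hcube[OF assms(3)])
  then have "l = m" using assms(2,3) by (simp add: power_eq_iff_eq_base)
  with ab show ?thesis by simp
qed

text \<open>A point of \<open>E\<close> closer than a quarter of the side would still lie in the cube, since
  each coordinate moves by less than that.\<close>

lemma infdist_central_half:
  fixes x a :: "real ^ 'n"
  assumes free: "E \<inter> hcube a l = {}" and "E \<noteq> {}" "0 < l"
    and x: "x \<in> hcube (\<chi> i. a $ i + l / 4) (l / 2)"
  shows "l / 4 \<le> infdist x E"
proof (rule ccontr)
  assume "\<not> l / 4 \<le> infdist x E"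
  then have "(INF e\<in>E. dist x e) < l / 4"
    using \<open>E \<noteq> {}\<close> by (simp add: infdist_notempty)
  then obtain e where e: "e \<in> E" "dist x e < l / 4"
    using \<open>E \<noteq> {}\<close> by (subst (asm) cINF_less_iff) (auto intro: bdd_belowI[where m=0])
  have "a $ i \<le> e $ i \<and> e $ i < a $ i + l" for i
  proof -
    have "\<bar>x $ i - e $ i\<bar> < l / 4"
      using e(2) component_le_norm_cart[of "x - e" i] by (simp add: dist_norm)
    moreover have "a $ i + l / 4 \<le> x $ i" "x $ i < a $ i + l / 4 + l / 2"
      using x by (auto simp: hcube_def)
    ultimately show ?thesis by linarith
  qed
  then have "e \<in> hcube a l" by (simp add: hcube_def)
  with free e show False by blast
qed

section \<open>From weak porosity to spread of the distance\<close>

lemma dyadic_hcubeE: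
  assumes "Q \<in> dyadic (hcube a l)" "0 < l"
  obtains b j where "Q = hcube b (l / 2 ^ j)" "hcube b (l / 2 ^ j) \<subseteq> hcube a l"
proof -
  from assms(1) obtain j a' l' k where *: "0 < l'" "hcube a l = hcube a' l'" "\<forall>i. k i < 2 ^ j"
     "Q = hcube (\<chi> i. a' $ i + real (k i) * (l' / 2 ^ j)) (l' / 2 ^ j)"
    unfolding dyadic_def dyadic_gen_def by auto
  from hcube_inject[OF *(2) assms(2) *(1)] have [simp]: "a' = a" "l' = l" by auto
  let ?b = "\<chi> i. a $ i + real (k i) * (l / 2 ^ j)"
  have "x \<in> hcube a l" if x: "x \<in> hcube ?b (l / 2 ^ j)" for x
  proof -
    have "a $ i \<le> x $ i \<and> x $ i < a $ i + l" for i
    proof -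
      have s: "0 \<le> l / 2 ^ j" using assms(2) by simp
      have "real (k i) + 1 \<le> 2 ^ j"
        using *(3)[rule_format, of i] by (metis Suc_leI of_nat_Suc of_nat_le_iff of_nat_numeral of_nat_power add.commute)
      then have "(real (k i) + 1) * (l / 2 ^ j) \<le> 2 ^ j * (l / 2 ^ j)"
        using s by (rule mult_right_mono)
      then have "real (k i) * (l / 2 ^ j) + l / 2 ^ j \<le> l"
        by (simp only: distrib_right mult_1 nonzero_mult_div_cancel_left) simp
      moreover have "0 \<le> real (k i) * (l / 2 ^ j)" using s by (intro mult_nonneg_nonneg) auto
      moreover have "a $ i + real (k i) * (l / 2 ^ j) \<le> x $ i"
          "x $ i < a $ i + real (k i) * (l / 2 ^ j) + l / 2 ^ j"
        using x by (auto simp: hcube_def)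
      ultimately show ?thesis by linarith
    qed
    then show ?thesis by (simp add: hcube_def)
  qed
  then show thesis using *(4) by (intro that[of ?b j]) auto
qed

lemma dyadic_hcube_containing:
  assumes "y \<in> hcube a l" "0 < l"
  obtains b where "hcube b (l / 2 ^ j) \<in> dyadic (hcube a l)" "y \<in> hcube b (l / 2 ^ j)"
proof -
  define s where "s = l / 2 ^ j"
  have s: "0 < s" using assms(2) by (simp add: s_def)
  define k where "k i = nat \<lfloor>(y $ i - a $ i) / s\<rfloor>" for i
  have y: "a $ i \<le> y $ i" "y $ i < a $ i + l" for i
    using assms(1) by (auto simp: hcube_def)
  have k: "real (k i) * s \<le> y $ i - a $ i" "y $ i - a $ i < real (k i) * s + s" for i
  proof -
    have nn: "0 \<le> (y $ i - a $ i) / s" using y s by simp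
    have rk: "real (k i) = of_int \<lfloor>(y $ i - a $ i) / s\<rfloor>"
      using nn by (simp add: k_def)
    have "real (k i) \<le> (y $ i - a $ i) / s" unfolding rk by simp
    then show "real (k i) * s \<le> y $ i - a $ i" using s by (simp add: field_simps)
    have "(y $ i - a $ i) / s < real (k i) + 1" unfolding rk by linarith
    then show "y $ i - a $ i < real (k i) * s + s" using s by (simp add: field_simps)
  qed
  have kj: "k i < 2 ^ j" for i
  proof -
    have "real (k i) * s < 2 ^ j * s" using k(1)[of i] y(2)[of i] by (simp add: s_def)
    then have "real (k i) < 2 ^ j" using s by simp
    then show ?thesis by (metis of_nat_less_iff of_nat_numeral of_nat_power)
  qed
  define b where "b = (\<chi> i. a $ i + real (k i) * s)"
  have "hcube b (l / 2 ^ j) \<in> dyadic_gen j (hcube a l)"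
    using kj assms(2) unfolding dyadic_gen_def b_def s_def by blast
  moreover have "y \<in> hcube b (l / 2 ^ j)"
  proof -
    have "b $ i \<le> y $ i \<and> y $ i < b $ i + s" for i
      using k[of i] by (simp add: b_def)
    then show ?thesis by (simp add: hcube_def s_def)
  qed
  ultimately show thesis by (intro that) (auto simp: dyadic_def)
qed

text \<open>The choice in \<open>max_free\<close> is legitimate: volumes of dyadic subcubes decrease with the generation,
  so a free cube of the least possible generation is largest.\<close>

lemma max_free_maximal:
  fixes a :: "real ^ 'n"
  assumes "free_dyadic E (hcube a l) \<noteq> {}" "0 < l" and Q: "Q \<in> free_dyadic E (hcube a l)"
  shows "measure lebesgue Q \<le> measure lebesgue (max_free E (hcube a l))"
proof -
  define J where "J j \<longleftrightarrow> (\<exists>b. hcube b (l / 2 ^ j) \<in> free_dyadic E (hcube a l))" for j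
  have gen: "\<exists>b j. Q' = hcube b (l / 2 ^ j) \<and> J j" if "Q' \<in> free_dyadic E (hcube a l)" for Q'
  proof -
    have "Q' \<in> dyadic (hcube a l)" using that by (simp add: free_dyadic_def)
    then obtain b j where b: "Q' = hcube b (l / 2 ^ j)" using dyadic_hcubeE assms(2) by metis
    then have "J j" using that unfolding J_def by blast
    with b show ?thesis by blast
  qed
  have ex: "\<exists>j. J j" using assms(1) gen by blast
  define m where "m = (LEAST j. J j)"
  have "J m" unfolding m_def using ex by (rule LeastI_ex)
  then obtain b where b: "hcube b (l / 2 ^ m) \<in> free_dyadic E (hcube a l)" by (auto simp: J_def)
  have "measure lebesgue Q' \<le> measure lebesgue (hcube b (l / 2 ^ m))"
    if Q': "Q' \<in> free_dyadic E (hcube a l)" for Q'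
  proof -
    obtain b' j where j: "Q' = hcube b' (l / 2 ^ j)" "J j" using gen[OF Q'] by blast
    have "m \<le> j" unfolding m_def using j(2) by (rule Least_le)
    then have "l / 2 ^ j \<le> l / 2 ^ m"
      using assms(2) by (intro divide_left_mono) (auto intro: power_increasing)
    then have "(l / 2 ^ j) ^ CARD('n) \<le> (l / 2 ^ m) ^ CARD('n)"
      using assms(2) by (intro power_mono) auto
    then show ?thesis using assms(2) by (simp add: j(1) measure_hcube)
  qed
  then have "\<exists>Q. Q \<in> free_dyadic E (hcube a l) \<and>
     (\<forall>Q' \<in> free_dyadic E (hcube a l). measure lebesgue Q' \<le> measure lebesgue Q)"
    using b by blast
  from someI_ex[OF this] Q show ?thesis unfolding max_free_def by blast
qed

text \<open>Among the dyadic cubes containing \<open>y\<close>, the first one whose diameter bound drops below the distance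
  of \<open>y\<close> from \<open>E\<close> is free, and its parent had not yet dropped below it. The upper bound on the
  distance is what makes this work when already the whole cube is small enough.\<close>

lemma free_dyadic_large:
  fixes y :: "real ^ 'n"
  assumes "0 < l" "y \<in> hcube a l" "0 < infdist y E" "infdist y E \<le> 2 * real CARD('n) * l"
  obtains b s where "hcube b s \<in> free_dyadic E (hcube a l)" "infdist y E / (2 * real CARD('n)) \<le> s"
proof -
  let ?n = "real CARD('n)"
  let ?d = "infdist y E"
  have n: "0 < ?n" by simp
  define G where "G j \<longleftrightarrow> ?n * (l / 2 ^ j) < ?d" for j
  have "\<exists>j. G j"
  proof -
    obtain j where "?n * l / ?d < 2 ^ j" using real_arch_pow[of 2 "?n * l / ?d"] by auto
    then show ?thesis using assms(3) unfolding G_def by (intro exI[of _ j]) (simp add: field_simps)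
  qed
  define m where "m = (LEAST j. G j)"
  have Gm: "G m" unfolding m_def using \<open>\<exists>j. G j\<close> by (rule LeastI_ex)
  have large: "?d / (2 * ?n) \<le> l / 2 ^ m"
  proof (cases m)
    case 0
    then show ?thesis using assms(4) n by (simp add: field_simps)
  next
    case (Suc j)
    then have "\<not> G j" unfolding m_def using not_less_Least by (metis lessI)
    then show ?thesis using n unfolding G_def Suc by (simp add: field_simps)
  qed
  obtain b where b: "hcube b (l / 2 ^ m) \<in> dyadic (hcube a l)" "y \<in> hcube b (l / 2 ^ m)"
    using dyadic_hcube_containing[OF assms(2,1)] .
  have "E \<inter> hcube b (l / 2 ^ m) = {}"
  proof (rule ccontr)
    assume "E \<inter> hcube b (l / 2 ^ m) \<noteq> {}"
    then obtain e where e: "e \<in> E" "e \<in> hcube b (l / 2 ^ m)" by blast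
    have "?d \<le> dist y e" using e(1) by (rule infdist_le)
    also have "\<dots> \<le> ?n * (l / 2 ^ m)" using b(2) e(2) by (rule dist_hcube)
    finally show False using Gm by (simp add: G_def)
  qed
  with b(1) large show thesis by (intro that) (auto simp: free_dyadic_def)
qed

lemma central_half_subset: "0 < l \<Longrightarrow> hcube (\<chi> i. a $ i + l / 4) (l / 2) \<subseteq> hcube a l"
proof
  fix x assume l: "0 < l" and x: "x \<in> hcube (\<chi> i. a $ i + l / 4) (l / 2)"
  have "a $ i \<le> x $ i \<and> x $ i < a $ i + l" for i
  proof -
    have "a $ i + l / 4 \<le> x $ i" "x $ i < a $ i + l / 4 + l / 2"
      using x by (auto simp: hcube_def)
    then show ?thesis using l by linarith
  qed
  then show "x \<in> hcube a l" by (simp add: hcube_def)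
qed

lemma superlevel_measurable [measurable]: "{x \<in> hcube a l. t \<le> infdist x E} \<in> sets lebesgue"
proof -
  have "{x \<in> hcube a l. t \<le> infdist x E} = hcube a l \<inter> {x. t \<le> infdist x E}" by auto
  also have "\<dots> \<in> sets lebesgue"
    by (intro sets.Int hcube_lebesgue sets_completionI_sets, simp)
       (intro borel_closed closed_Collect_le continuous_intros)
  finally show ?thesis .
qed

lemma superlevel_lmeasurable: "0 < l \<Longrightarrow> {x \<in> hcube a l. t \<le> infdist x E} \<in> lmeasurable"
  by (rule fmeasurableI2[OF hcube_lmeasurable[of l a]]) (auto simp: superlevel_measurable)

text \<open>If the distance of \<open>y\<close> from \<open>E\<close> exceeds twice the diameter bound of the cube, it changes at most by
  a factor two on the cube. Otherwise the largest free dyadic cube has side comparable to that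
  distance, and weak porosity supplies disjoint free cubes of comparable size which fill a fixed
  proportion; their central halves do the job.\<close>

proposition weakly_porous_spread:
  fixes E :: "(real ^ 'n) set"
  assumes "weakly_porous E"
  obtains c \<delta> where "0 < c" "c < 1" "0 < \<delta>" "\<delta> < 1"
    "\<And>a l y. 0 < l \<Longrightarrow> y \<in> hcube a l \<Longrightarrow>
       c * l ^ CARD('n) \<le> measure lebesgue {x \<in> hcube a l. \<delta> * infdist y E \<le> infdist x E}"
    "\<And>a l. 0 < l \<Longrightarrow> \<exists>y\<in>hcube a l. 0 < infdist y E"
proof -
  let ?n = "real CARD('n)"
  have n: "1 \<le> ?n" using zero_less_card_finite[where 'a='n] by linarith
  from assms obtain c \<delta> where ne: "E \<noteq> {}" and cd: "0 < c" "c < 1" "0 < \<delta>" "\<delta> < 1"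
    and wp0: "\<forall>P. is_cube P \<longrightarrow>
         (\<exists>(N::nat) Q. 1 \<le> N \<and> disjoint_family_on Q {1..N} \<and>
           (\<forall>k\<in>{1..N}. Q k \<in> free_dyadic E P \<and>
              measure lebesgue (Q k) \<ge> \<delta> * measure lebesgue (max_free E P)) \<and>
           (\<Sum>k=1..N. measure lebesgue (Q k)) \<ge> c * measure lebesgue P)"
    unfolding weakly_porous_def by blast
  have wp: "\<exists>(N::nat) Q. 1 \<le> N \<and> disjoint_family_on Q {1..N} \<and>
           (\<forall>k\<in>{1..N}. Q k \<in> free_dyadic E (hcube a l) \<and>
              measure lebesgue (Q k) \<ge> \<delta> * measure lebesgue (max_free E (hcube a l))) \<and>
           (\<Sum>k=1..N. measure lebesgue (Q k)) \<ge> c * l ^ CARD('n)" if "0 < l" for a :: "real ^ 'n" and l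
    using wp0[rule_format, of "hcube a l"] that unfolding measure_hcube[OF that, of a]
    by (auto simp: is_cube_def)
  have pos: "\<exists>y\<in>hcube a l. 0 < infdist y E" if l: "0 < l" for a :: "real ^ 'n" and l
  proof -
    obtain N Q where "1 \<le> (N::nat)" "\<forall>k\<in>{1..N}. Q k \<in> free_dyadic E (hcube a l)"
      using wp[OF l, of a] by blast
    then have Q1: "Q 1 \<in> dyadic (hcube a l)" "E \<inter> Q 1 = {}" by (auto simp: free_dyadic_def)
    then obtain b j where b: "Q 1 = hcube b (l / 2 ^ j)" "hcube b (l / 2 ^ j) \<subseteq> hcube a l"
      using dyadic_hcubeE l by metis
    define s where "s = l / 2 ^ j"
    have s: "0 < s" using l by (simp add: s_def)
    let ?y = "\<chi> i. b $ i + s / 4"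
    have y: "?y \<in> hcube ?y (s / 2)" using s by (intro hcube_corner) simp
    have "s / 4 \<le> infdist ?y E"
      using infdist_central_half[OF _ ne s y] Q1(2) b(1) by (simp add: s_def)
    moreover have "?y \<in> hcube a l"
      using y central_half_subset[OF s, of b] b(2) by (auto simp: s_def)
    ultimately show ?thesis using s by (intro bexI[of _ ?y]) auto
  qed
  \<comment> \<open>The factor \<open>8 n\<close> collects \<open>2 n\<close> from the size of a large free cube and \<open>4\<close> from the
    distance of its central half to \<open>E\<close>; halving the side costs \<open>2\<^sup>n\<close> in volume.\<close>
  define \<delta>' where "\<delta>' = \<delta> / (8 * ?n)"
  define c' where "c' = c / 2 ^ CARD('n)"
  have d': "0 < \<delta>'" "\<delta>' < 1" "\<delta>' \<le> 1 / 2"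
  proof -
    have "\<delta>' \<le> \<delta> / 8"
      unfolding \<delta>'_def using cd n by (intro divide_left_mono) auto
    moreover show "0 < \<delta>'" using cd n by (simp add: \<delta>'_def)
    ultimately show "\<delta>' < 1" "\<delta>' \<le> 1 / 2" using cd by auto
  qed
  have p2: "(1::real) \<le> 2 ^ CARD('n)" by (rule one_le_power) simp
  have c': "0 < c'" "c' < 1" using cd p2 by (auto simp: c'_def intro: less_le_trans)
  have "c' * l ^ CARD('n) \<le> measure lebesgue {x \<in> hcube a l. \<delta>' * infdist y E \<le> infdist x E}"
    if l: "0 < l" and y: "y \<in> hcube a l" for a y :: "real ^ 'n" and l
  proof -
    let ?D = "{x \<in> hcube a l. \<delta>' * infdist y E \<le> infdist x E}"
    have D: "?D \<in> lmeasurable" using l by (rule superlevel_lmeasurable)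
    show ?thesis
    proof (cases "infdist y E \<le> 2 * ?n * l \<and> 0 < infdist y E")
      case False
      have "hcube a l = ?D"
      proof -
        have "\<delta>' * infdist y E \<le> infdist x E" if x: "x \<in> hcube a l" for x
        proof (cases "infdist y E = 0")
          case False
          then have "2 * ?n * l < infdist y E"
            using \<open>\<not> (infdist y E \<le> 2 * ?n * l \<and> 0 < infdist y E)\<close> infdist_nonneg[of y E] by linarith
          moreover have "infdist y E \<le> infdist x E + ?n * l" using y x by (rule infdist_hcube)
          ultimately have "infdist y E / 2 \<le> infdist x E" by linarith
          moreover have "\<delta>' * infdist y E \<le> 1 / 2 * infdist y E"
            using d'(3) infdist_nonneg[of y E] by (rule mult_right_mono)
          ultimately show ?thesis by linarith
        qed (simp add: infdist_nonneg)
        then show ?thesis by blast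
      qed
      then have "measure lebesgue ?D = l ^ CARD('n)" using measure_hcube[OF l, of a] by simp
      then show ?thesis using c' l by (simp add: mult_left_le_one_le)
    next
      case True
      then obtain b s where bs: "hcube b s \<in> free_dyadic E (hcube a l)" "infdist y E / (2 * ?n) \<le> s"
        using free_dyadic_large[OF l y] by blast
      define u where "u = infdist y E / (2 * ?n)"
      have u: "0 < u" using True n by (simp add: u_def)
      have s: "0 < s" using u bs(2) by (simp add: u_def)
      obtain N Q where Q: "1 \<le> (N::nat)" "disjoint_family_on Q {1..N}"
        "\<And>k. k \<in> {1..N} \<Longrightarrow> Q k \<in> free_dyadic E (hcube a l)"
        "\<And>k. k \<in> {1..N} \<Longrightarrow> measure lebesgue (Q k) \<ge> \<delta> * measure lebesgue (max_free E (hcube a l))"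
        "(\<Sum>k=1..N. measure lebesgue (Q k)) \<ge> c * l ^ CARD('n)"
        using wp[OF l, of a] by blast
      have "\<exists>b t. 0 < t \<and> Q k = hcube b t \<and> hcube b t \<subseteq> hcube a l \<and> \<delta> * u \<le> t" if k: "k \<in> {1..N}" for k
      proof -
        have "Q k \<in> dyadic (hcube a l)" using Q(3)[OF k] by (simp add: free_dyadic_def)
        then obtain b' j where b': "Q k = hcube b' (l / 2 ^ j)" "hcube b' (l / 2 ^ j) \<subseteq> hcube a l"
          using dyadic_hcubeE l by metis
        define t where "t = l / 2 ^ j"
        have t: "0 < t" using l by (simp add: t_def)
        \<comment> \<open>The volumes differ by a factor \<open>\<delta>\<close>, hence the sides by \<open>\<delta>\<^sup>1\<^sup>/\<^sup>n \<ge> \<delta>\<close>.\<close>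
        have "\<delta> * u \<le> t"
        proof (rule ccontr)
          assume "\<not> \<delta> * u \<le> t"
          then have "t ^ CARD('n) < (\<delta> * u) ^ CARD('n)" using t by (intro power_strict_mono) auto
          also have "\<dots> = \<delta> ^ CARD('n) * u ^ CARD('n)" by (rule power_mult_distrib)
          also have "\<dots> \<le> \<delta> * u ^ CARD('n)"
            using cd u power_decreasing[of 1 "CARD('n)" \<delta>]
            by (intro mult_right_mono) (auto simp: Suc_le_eq)
          also have "\<dots> \<le> \<delta> * s ^ CARD('n)"
            using cd u bs(2) by (intro mult_left_mono power_mono) (auto simp: u_def)
          also have "\<dots> = \<delta> * measure lebesgue (hcube b s)" by (simp add: measure_hcube s)
          also have "\<dots> \<le> \<delta> * measure lebesgue (max_free E (hcube a l))"
            using cd bs(1) l by (intro mult_left_mono max_free_maximal) auto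
          also have "\<dots> \<le> measure lebesgue (Q k)" using Q(4) k .
          also have "\<dots> = t ^ CARD('n)" by (simp add: b'(1) t_def[symmetric] measure_hcube t)
          finally show False by simp
        qed
        then show ?thesis using b' t unfolding t_def by blast
      qed
      then obtain b t where bt: "\<And>k. k \<in> {1..N} \<Longrightarrow> 0 < t k" "\<And>k. k \<in> {1..N} \<Longrightarrow> Q k = hcube (b k) (t k)"
        "\<And>k. k \<in> {1..N} \<Longrightarrow> hcube (b k) (t k) \<subseteq> hcube a l" "\<And>k. k \<in> {1..N} \<Longrightarrow> \<delta> * u \<le> t k"
        by metis
      define H where "H k = hcube (\<chi> i. b k $ i + t k / 4) (t k / 2)" for k
      have HQ: "H k \<subseteq> Q k" if "k \<in> {1..N}" for k
        using central_half_subset[OF bt(1)[OF that]] bt(2)[OF that] by (simp add: H_def)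
      have "(\<Sum>k=1..N. measure lebesgue (H k)) = measure lebesgue (\<Union>k\<in>{1..N}. H k)"
      proof (rule measure_finite_Union[symmetric])
        show "disjoint_family_on H {1..N}"
          using Q(2) HQ unfolding disjoint_family_on_def by blast
        show "emeasure lebesgue (H k) \<noteq> \<infinity>" if "k \<in> {1..N}" for k
          using bt(1)[OF that] by (simp add: H_def emeasure_hcube del: emeasure_lborel_box)
      qed (auto simp: H_def)
      also have "\<dots> \<le> measure lebesgue ?D"
      proof (rule measure_mono_fmeasurable[OF _ _ D])
        show "(\<Union>k\<in>{1..N}. H k) \<subseteq> ?D"
        proof (rule UN_least)
          fix k assume k: "k \<in> {1..N}"
          show "H k \<subseteq> ?D"
          proof
            fix x assume x: "x \<in> H k"
            have "t k / 4 \<le> infdist x E"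
              using infdist_central_half[of E "b k" "t k" x] Q(3)[OF k] ne bt(1)[OF k] x bt(2)[OF k]
              by (simp add: H_def free_dyadic_def)
            moreover have "\<delta>' * infdist y E = \<delta> * u / 4" by (simp add: \<delta>'_def u_def)
            ultimately have "\<delta>' * infdist y E \<le> infdist x E" using bt(4)[OF k] by linarith
            then show "x \<in> ?D" using x HQ[OF k] bt(2,3)[OF k] by auto
          qed
        qed
      qed (auto simp: H_def)
      finally have 1: "(\<Sum>k=1..N. measure lebesgue (H k)) \<le> measure lebesgue ?D" .
      have "c' * l ^ CARD('n) \<le> (\<Sum>k=1..N. measure lebesgue (Q k)) / 2 ^ CARD('n)"
        unfolding c'_def using Q(5) p2 by (simp add: field_simps)
      also have "\<dots> = (\<Sum>k=1..N. measure lebesgue (H k))"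
        unfolding sum_divide_distrib
        by (rule sum.cong) (auto simp: H_def bt(1,2) measure_hcube power_divide)
      finally show ?thesis using 1 by linarith
    qed
  qed
  with that c' d'(1,2) pos show thesis by blast
qed

section \<open>Halving cubes\<close>

text \<open>The \<open>2\<^sup>n\<close> half cubes of a cube are indexed by the set of coordinates in which the upper half is
  taken.\<close>

definition half_cube :: "real ^ 'n \<Rightarrow> real \<Rightarrow> 'n set \<Rightarrow> (real ^ 'n) set" where
  "half_cube a l S = hcube (\<chi> i. a $ i + (if i \<in> S then l / 2 else 0)) (l / 2)"

lemma indicator_half_cubes:
  "(indicator (hcube (a :: real ^ 'n) l) x :: ennreal) = (\<Sum>S\<in>UNIV. indicator (half_cube a l S) x)"
proof -
  define T where "T = {i. a $ i + l / 2 \<le> x $ i}"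
  have iff: "x \<in> half_cube a l S \<longleftrightarrow> x \<in> hcube a l \<and> S = T" for S
  proof
    assume x: "x \<in> half_cube a l S"
    have *: "a $ i + (if i \<in> S then l / 2 else 0) \<le> x $ i"
      "x $ i < a $ i + (if i \<in> S then l / 2 else 0) + l / 2" for i
      using x by (auto simp: half_cube_def hcube_def)
    have "i \<in> S \<longleftrightarrow> i \<in> T" for i
      using *[of i] by (auto simp: T_def split: if_splits)
    moreover have "a $ i \<le> x $ i \<and> x $ i < a $ i + l" for i
      using *[of i] by (cases "i \<in> S") auto
    ultimately show "x \<in> hcube a l \<and> S = T" by (auto simp: hcube_def)
  next
    assume x: "x \<in> hcube a l \<and> S = T"
    then have *: "a $ i \<le> x $ i" "x $ i < a $ i + l" for i by (auto simp: hcube_def)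
    have "a $ i + (if i \<in> S then l / 2 else 0) \<le> x $ i \<and>
      x $ i < a $ i + (if i \<in> S then l / 2 else 0) + l / 2" for i
      using *[of i] x by (auto simp: T_def)
    then show "x \<in> half_cube a l S" by (simp add: half_cube_def hcube_def)
  qed
  have "(\<Sum>S\<in>UNIV. indicator (half_cube a l S) x :: ennreal) =
      (\<Sum>S\<in>UNIV. if S = T then indicator (hcube a l) x else 0)"
    by (rule sum.cong) (auto simp: indicator_def iff)
  also have "\<dots> = indicator (hcube a l) x" by simp
  finally show ?thesis by simp
qed

lemma nn_integral_half_cubes:
  fixes f :: "real ^ 'n \<Rightarrow> ennreal"
  assumes f [measurable]: "f \<in> borel_measurable lebesgue"
  shows "(\<integral>\<^sup>+x\<in>hcube a l. f x \<partial>lebesgue) = (\<Sum>S\<in>UNIV. \<integral>\<^sup>+x\<in>half_cube a l S. f x \<partial>lebesgue)"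
proof -
  have "(\<integral>\<^sup>+x\<in>hcube a l. f x \<partial>lebesgue) = (\<integral>\<^sup>+x. (\<Sum>S\<in>UNIV. f x * indicator (half_cube a l S) x) \<partial>lebesgue)"
    by (simp only: indicator_half_cubes sum_distrib_left)
  also have "\<dots> = (\<Sum>S\<in>UNIV. \<integral>\<^sup>+x\<in>half_cube a l S. f x \<partial>lebesgue)"
    by (rule nn_integral_sum) (auto simp: half_cube_def intro!: borel_measurable_times_ennreal f borel_measurable_indicator)
  finally show ?thesis .
qed

lemma infdist_borel [measurable]: "(\<lambda>x :: real ^ 'n. infdist x E) \<in> borel_measurable borel"
  by (intro borel_measurable_continuous_onI continuous_intros)

lemma sublevel_lebesgue [measurable]:
  "{x :: real ^ 'n. infdist x E < s} \<in> sets lebesgue" "{x :: real ^ 'n. infdist x E \<le> s} \<in> sets lebesgue"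
  by (intro sets_completionI_sets; simp)+

lemma cube_sublevel_lmeasurable: "0 < l \<Longrightarrow> hcube a l \<inter> {x. infdist x E < s} \<in> lmeasurable"
  by (rule fmeasurableI2[OF hcube_lmeasurable[of l a]]) (auto simp: sublevel_lebesgue hcube_lebesgue)

lemma emeasure_cube_sublevel:
  "0 < l \<Longrightarrow> ennreal (measure lebesgue (hcube a l \<inter> {x. infdist x E < s})) =
     (\<integral>\<^sup>+x. indicator (hcube a l \<inter> {x. infdist x E < s}) x \<partial>lebesgue)"
  using cube_sublevel_lmeasurable[of l a E s]
  by (simp only: nn_integral_indicator fmeasurableD emeasure_eq_measure2)

section \<open>Doubling and localisation\<close>

text \<open>The two properties of the distance function that weak porosity gives and the remaining arguments
  use. Positivity is a separate assumption because \<open>spread\<close> says nothing on a cube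
  where the distance vanishes.\<close>

locale spread_distance =
  fixes E :: "(real ^ 'n) set" and c \<delta> :: real
  assumes nonempty: "E \<noteq> {}"
    and c: "0 < c" "c < 1" and \<delta>: "0 < \<delta>" "\<delta> < 1"
    and spread: "\<And>a l y. 0 < l \<Longrightarrow> y \<in> hcube a l \<Longrightarrow>
       c * l ^ CARD('n) \<le> measure lebesgue {x \<in> hcube a l. \<delta> * infdist y E \<le> infdist x E}"
    and positive: "\<And>a l. 0 < l \<Longrightarrow> \<exists>y\<in>hcube a l. 0 < infdist y E"
begin

text \<open>The part of the large cube outside the small one is too small to contain the spread set.\<close>

lemma spread_into_subcube:
  assumes l: "0 < l" "0 < L" and sub: "hcube b l \<subseteq> hcube a L"
    and big: "(1 - c) * L ^ CARD('n) < l ^ CARD('n)" and y: "y \<in> hcube a L"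
  shows "\<exists>x\<in>hcube b l. \<delta> * infdist y E \<le> infdist x E"
proof (rule ccontr)
  let ?D = "{x \<in> hcube a L. \<delta> * infdist y E \<le> infdist x E}"
  assume "\<not> ?thesis"
  then have "?D \<subseteq> hcube a L - hcube b l" by blast
  then have "measure lebesgue ?D \<le> measure lebesgue (hcube a L - hcube b l)"
    by (rule measure_mono_fmeasurable)
      (auto simp: superlevel_measurable intro!: fmeasurable.Diff hcube_lmeasurable l)
  also have "\<dots> = L ^ CARD('n) - l ^ CARD('n)"
    by (subst measurable_measure_Diff)
       (use sub l in \<open>auto simp: hcube_lmeasurable measure_hcube\<close>)
  finally show False using spread[OF l(2) y] big by (simp add: algebra_simps)
qed

text \<open>Iterates \<open>spread_into_subcube\<close> along cubes that grow from \<open>hcube b l\<close> by factors of at most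
  \<open>1 / \<rho>\<close>. They share one corner, selected by \<open>S\<close>: in the directions of \<open>S\<close> they grow downwards, in the
  others upwards.\<close>

lemma spread_corner_chain:
  assumes lam: "0 < \<rho>" "\<rho> < 1" "1 - c < \<rho> ^ CARD('n)"
  shows "0 < l \<Longrightarrow> l \<le> L \<Longrightarrow> L * \<rho> ^ N \<le> l \<Longrightarrow>
    y \<in> hcube (\<chi> i. b $ i - (if i \<in> S then L - l else 0)) L \<Longrightarrow>
    \<exists>x\<in>hcube b l. \<delta> ^ N * infdist y E \<le> infdist x E"
proof (induction N arbitrary: L y)
  case 0
  then have [simp]: "L = l" by simp
  have "(\<chi> i. b $ i - (if i \<in> S then L - l else 0)) = b" by (simp add: vec_eq_iff)
  with 0(4) show ?case by auto
next
  case (Suc N)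
  define m where "m = max l (\<rho> * L)"
  have L: "0 < L" using Suc.prems by simp
  have m: "l \<le> m" "m \<le> L" "\<rho> * L \<le> m" "0 < m"
    using Suc.prems lam L by (auto simp: m_def less_max_iff_disj)
  have sub: "hcube (\<chi> i. b $ i - (if i \<in> S then m - l else 0)) m
      \<subseteq> hcube (\<chi> i. b $ i - (if i \<in> S then L - l else 0)) L"
  proof
    fix x assume x: "x \<in> hcube (\<chi> i. b $ i - (if i \<in> S then m - l else 0)) m"
    have "b $ i - (if i \<in> S then L - l else 0) \<le> x $ i \<and>
        x $ i < b $ i - (if i \<in> S then L - l else 0) + L" for i
    proof -
      have "b $ i - (if i \<in> S then m - l else 0) \<le> x $ i"
        "x $ i < b $ i - (if i \<in> S then m - l else 0) + m"
        using x by (auto simp: hcube_def)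
      then show ?thesis using m(2) by (auto split: if_splits)
    qed
    then show "x \<in> hcube (\<chi> i. b $ i - (if i \<in> S then L - l else 0)) L" by (simp add: hcube_def)
  qed
  have "(1 - c) * L ^ CARD('n) < \<rho> ^ CARD('n) * L ^ CARD('n)"
    using lam(3) L by simp
  also have "\<dots> = (\<rho> * L) ^ CARD('n)" by (simp add: power_mult_distrib)
  also have "\<dots> \<le> m ^ CARD('n)" using m lam L by (intro power_mono) auto
  finally obtain x where x: "x \<in> hcube (\<chi> i. b $ i - (if i \<in> S then m - l else 0)) m"
      "\<delta> * infdist y E \<le> infdist x E"
    using spread_into_subcube[OF m(4) L sub _ Suc.prems(4)] by blast
  have "m * \<rho> ^ N \<le> l"
  proof (cases "m = l")
    case True
    then show ?thesis using lam Suc.prems(1) by (simp add: mult_left_le power_le_one)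
  next
    case False
    then have "m = \<rho> * L" by (auto simp: m_def)
    then show ?thesis using Suc.prems(3) by (simp add: mult_ac)
  qed
  from Suc.IH[OF Suc.prems(1) m(1) this x(1)] obtain z where
    z: "z \<in> hcube b l" "\<delta> ^ N * infdist x E \<le> infdist z E" by blast
  have "\<delta> ^ Suc N * infdist y E = \<delta> ^ N * (\<delta> * infdist y E)" by simp
  also have "\<dots> \<le> \<delta> ^ N * infdist x E" using x(2) \<delta> by (intro mult_left_mono) auto
  finally show ?case using z by (intro bexI[of _ z] order_trans[OF _ z(2)])
qed

text \<open>A half cube is joined to the full cube by a chain of cubes sharing the common corner, each of
  which fills more than \<open>1 - c\<close> of the volume of the next. The number of links depends only on \<open>c\<close> and
  the dimension.\<close>

lemma doubling:
  obtains \<eta> where "0 < \<eta>" "\<eta> \<le> 1"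
    "\<And>a l y S. 0 < l \<Longrightarrow> y \<in> hcube a l \<Longrightarrow> \<exists>x\<in>half_cube a l S. \<eta> * infdist y E \<le> infdist x E"
proof -
  \<comment> \<open>Bernoulli's inequality gives \<open>\<rho>\<^sup>n \<ge> 1 - c / 2\<close>.\<close>
  define \<rho> where "\<rho> = 1 - c / (2 * real CARD('n))"
  have n: "1 \<le> real CARD('n)" using zero_less_card_finite[where 'a='n] by linarith
  have "c / (2 * real CARD('n)) \<le> c / 2" using c n by (intro divide_left_mono) auto
  moreover have "0 < c / (2 * real CARD('n))" using c n by simp
  ultimately have lam: "0 < \<rho>" "\<rho> < 1"
    using c unfolding \<rho>_def by linarith+
  have "1 + real CARD('n) * (\<rho> - 1) \<le> \<rho> ^ CARD('n)"
    using Bernoulli_inequality[of "\<rho> - 1" "CARD('n)"] lam by simp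
  moreover have "1 + real CARD('n) * (\<rho> - 1) = 1 - c / 2" by (simp add: \<rho>_def)
  ultimately have lam3: "1 - c < \<rho> ^ CARD('n)" using c by linarith
  obtain N where N: "\<rho> ^ N < 1 / 2"
    using real_arch_pow_inv[of "1/2" \<rho>] lam by auto
  show thesis
  proof (rule that[of "\<delta> ^ N"])
    show "0 < \<delta> ^ N" "\<delta> ^ N \<le> 1" using \<delta> by (auto intro: power_le_one)
    fix a y :: "real ^ 'n" and l :: real and S
    assume l: "0 < l" and y: "y \<in> hcube a l"
    let ?b = "\<chi> i. a $ i + (if i \<in> S then l / 2 else 0)"
    have a: "(\<chi> i. ?b $ i - (if i \<in> S then l - l / 2 else 0)) = a"
      by (simp add: vec_eq_iff)
    have "l * \<rho> ^ N \<le> l / 2" using N l mult_left_mono[of "\<rho> ^ N" "1/2" l] by simp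
    then show "\<exists>x\<in>half_cube a l S. \<delta> ^ N * infdist y E \<le> infdist x E"
      using spread_corner_chain[OF lam lam3, of "l / 2" l N y ?b S] l y unfolding half_cube_def a by simp
  qed
qed

text \<open>Halve the cube repeatedly and stop at cubes on which the distance is at most \<open>(1 + n) s\<close>. A cube of
  side at most \<open>s\<close> is of this kind as soon as it meets the set where the distance is below \<open>s\<close>, and
  otherwise contributes nothing, so the process ends; this is the induction on \<open>j\<close>. By doubling every stopped cube still
  has a point at distance at least \<open>\<eta> s\<close>, so the hypothesis applies to it.\<close>

lemma local_to_global:
  fixes f :: "real ^ 'n \<Rightarrow> ennreal"
  assumes eta: "0 < \<eta>" "\<eta> \<le> 1"
    and dbl: "\<And>a l y S. 0 < l \<Longrightarrow> y \<in> hcube a l \<Longrightarrow> \<exists>x\<in>half_cube a l S. \<eta> * infdist y E \<le> infdist x E"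
    and f: "f \<in> borel_measurable lebesgue" and s: "0 < s" and l: "0 < l"
    and loc: "\<And>b m y. 0 < m \<Longrightarrow> y \<in> hcube b m \<Longrightarrow> \<eta> * s \<le> infdist y E \<Longrightarrow>
         (\<integral>\<^sup>+x\<in>hcube b m. f x \<partial>lebesgue) \<le> A * ennreal (m ^ CARD('n))"
    and far: "\<exists>y\<in>hcube a l. \<eta> * s \<le> infdist y E"
  shows "(\<integral>\<^sup>+x\<in>hcube a l. f x * indicator {x. infdist x E < s} x \<partial>lebesgue)
    \<le> A * ennreal (measure lebesgue (hcube a l \<inter> {x. infdist x E < 2 * (1 + real CARD('n)) * s}))"
proof -
  let ?L = "1 + real CARD('n)"
  let ?F = "\<lambda>x. f x * indicator {x. infdist x E < s} x"
  let ?G = "\<lambda>x :: real ^ 'n. indicator {x. infdist x E \<le> ?L * s} x :: ennreal"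
  have F: "?F \<in> borel_measurable lebesgue"
    by (intro borel_measurable_times_ennreal f borel_measurable_indicator sublevel_lebesgue)
  have G: "?G \<in> borel_measurable lebesgue"
    by (intro borel_measurable_indicator sublevel_lebesgue)
  \<comment> \<open>A stopped cube lies inside the set on the right, so the hypothesis on it is sharp enough.\<close>
  have near: "(\<integral>\<^sup>+x\<in>hcube a l. ?F x \<partial>lebesgue) \<le> A * (\<integral>\<^sup>+x\<in>hcube a l. ?G x \<partial>lebesgue)"
    if l: "0 < l" and far: "\<exists>y\<in>hcube a l. \<eta> * s \<le> infdist y E"
      and close: "\<And>y. y \<in> hcube a l \<Longrightarrow> infdist y E \<le> ?L * s" for a l
  proof -
    have "(\<integral>\<^sup>+x\<in>hcube a l. ?F x \<partial>lebesgue) \<le> (\<integral>\<^sup>+x\<in>hcube a l. f x \<partial>lebesgue)"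
      by (rule nn_integral_mono) (auto simp: indicator_def)
    also have "\<dots> \<le> A * ennreal (l ^ CARD('n))" using far loc[OF l] by blast
    also have "ennreal (l ^ CARD('n)) = (\<integral>\<^sup>+x. indicator (hcube a l) x \<partial>lebesgue)"
      by (simp only: nn_integral_indicator[OF hcube_lebesgue] emeasure_hcube[OF l])
    also have "\<dots> = (\<integral>\<^sup>+x\<in>hcube a l. ?G x \<partial>lebesgue)"
      by (rule nn_integral_cong) (auto simp: indicator_def close)
    finally show ?thesis .
  qed
  have step: "0 < l \<Longrightarrow> l \<le> 2 ^ j * s \<Longrightarrow> \<exists>y\<in>hcube a l. \<eta> * s \<le> infdist y E \<Longrightarrow>
     (\<integral>\<^sup>+x\<in>hcube a l. ?F x \<partial>lebesgue) \<le> A * (\<integral>\<^sup>+x\<in>hcube a l. ?G x \<partial>lebesgue)" for j a l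
  proof (induction j arbitrary: a l)
    case (0 a l)
    show ?case
    proof (cases "\<exists>x\<in>hcube a l. infdist x E < s")
      case True
      then obtain x where x: "x \<in> hcube a l" "infdist x E < s" by blast
      have nl: "real CARD('n) * l \<le> real CARD('n) * s"
        using 0(2) by (intro mult_left_mono) auto
      have "infdist y E \<le> ?L * s" if "y \<in> hcube a l" for y
        using infdist_hcube[OF that x(1), of E] x(2) nl unfolding distrib_right by linarith
      then show ?thesis using near 0 by blast
    next
      case False
      have "(\<integral>\<^sup>+x\<in>hcube a l. ?F x \<partial>lebesgue) = (\<integral>\<^sup>+x. 0 \<partial>(lebesgue :: (real ^ 'n) measure))"
        by (rule nn_integral_cong) (use False in \<open>auto simp: indicator_def\<close>)
      then show ?thesis by simp
    qed
  next
    case (Suc j a l)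
    show ?case
    proof (cases "\<forall>y\<in>hcube a l. infdist y E \<le> ?L * s")
      case True
      then show ?thesis using near Suc.prems by blast
    next
      case False
      then obtain y where y: "y \<in> hcube a l" "?L * s < infdist y E" by force
      have "s \<le> ?L * s" using s by (simp add: algebra_simps)
      with y have "s \<le> infdist y E" by linarith
      then have sy: "\<eta> * s \<le> \<eta> * infdist y E" using eta by (intro mult_left_mono) auto
      have half: "(\<integral>\<^sup>+x\<in>half_cube a l S. ?F x \<partial>lebesgue) \<le> A * (\<integral>\<^sup>+x\<in>half_cube a l S. ?G x \<partial>lebesgue)" for S
      proof -
        obtain x where "x \<in> half_cube a l S" "\<eta> * infdist y E \<le> infdist x E"
          using dbl[OF Suc.prems(1) y(1)] by blast
        then have "\<exists>x\<in>half_cube a l S. \<eta> * s \<le> infdist x E"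
          using sy by (intro bexI[of _ x]) auto
        then show ?thesis unfolding half_cube_def using Suc.prems by (intro Suc.IH) auto
      qed
      show ?thesis
        unfolding nn_integral_half_cubes[OF F] nn_integral_half_cubes[OF G] sum_distrib_left
        by (rule sum_mono) (rule half)
    qed
  qed
  obtain j where "l / s < 2 ^ j" using real_arch_pow[of 2 "l / s"] by auto
  then have "l \<le> 2 ^ j * s" using s by (simp add: field_simps)
  from step[OF l this far]
  have "(\<integral>\<^sup>+x\<in>hcube a l. ?F x \<partial>lebesgue) \<le> A * (\<integral>\<^sup>+x\<in>hcube a l. ?G x \<partial>lebesgue)" .
  also have "(\<integral>\<^sup>+x\<in>hcube a l. ?G x \<partial>lebesgue) \<le>
      (\<integral>\<^sup>+x. indicator (hcube a l \<inter> {x. infdist x E < 2 * ?L * s}) x \<partial>lebesgue)"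
  proof (rule nn_integral_mono)
    have "0 < ?L * s" using s by simp
    then have "?L * s < 2 * ?L * s" by linarith
    then show "?G x * indicator (hcube a l) x
        \<le> indicator (hcube a l \<inter> {x. infdist x E < 2 * ?L * s}) x" for x
      by (auto simp: indicator_def)
  qed
  also have "\<dots> = ennreal (measure lebesgue (hcube a l \<inter> {x. infdist x E < 2 * ?L * s}))"
    by (rule emeasure_cube_sublevel[OF l, symmetric])
  finally show ?thesis by (simp add: mult_left_mono)
qed

end

section \<open>Weight bounds and decay of sublevel sets\<close>

lemma dist_weight_cases:
  "dist_weight E \<beta> x = (if \<beta> = 0 then 1 else if infdist x E = 0 then (if \<beta> < 0 then 0 else \<infinity>)
     else ennreal (infdist x E powr - \<beta>))"
  by (auto simp: dist_weight_def epow_def infdist_nonneg)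

lemma dist_weight_pos:
  "0 < infdist x E \<Longrightarrow> dist_weight E \<beta> x = ennreal (infdist x E powr - \<beta>)"
  by (auto simp: dist_weight_cases)

lemma dist_weight_measurable: "dist_weight E \<beta> \<in> borel_measurable lebesgue"
proof -
  have "dist_weight E \<beta> \<in> borel_measurable borel"
    unfolding dist_weight_cases[abs_def] by measurable
  then show ?thesis by (simp add: measurable_completion)
qed

text \<open>For positive \<open>\<beta>\<close>, and with the constants left free, this is both the \<open>A\<^sub>1\<close> condition and what
  remains of the \<open>A\<^sub>p\<close> condition once the average of the dual weight is bounded from below.\<close>

definition weight_bound :: "(real ^ 'n) set \<Rightarrow> real \<Rightarrow> bool" where
  "weight_bound E \<beta> \<longleftrightarrow> (\<exists>C>0. \<forall>a l y. 0 < l \<longrightarrow> y \<in> hcube a l \<longrightarrow> 0 < infdist y E \<longrightarrow>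
     (\<integral>\<^sup>+x\<in>hcube a l. dist_weight E \<beta> x \<partial>lebesgue) \<le> ennreal (C * infdist y E powr - \<beta> * l ^ CARD('n)))"

text \<open>The counterpart of \<open>Mu_admissible\<close> for cubes: here the value of the distance at any point of the
  cube replaces the hole of the ball.\<close>

definition sublevel_decay :: "(real ^ 'n) set \<Rightarrow> real \<Rightarrow> bool" where
  "sublevel_decay E \<beta> \<longleftrightarrow> (\<exists>C>0. \<forall>a l y s. 0 < l \<longrightarrow> y \<in> hcube a l \<longrightarrow> 0 < infdist y E \<longrightarrow> 0 < s \<longrightarrow>
     measure lebesgue (hcube a l \<inter> {x. infdist x E < s}) \<le> C * (s / infdist y E) powr \<beta> * l ^ CARD('n))"

text \<open>The exponent is chosen so that \<open>\<rho>\<close> raised to it is \<open>\<theta>\<close>. The constant \<open>K / \<theta>\<close> pays for comparing \<open>s\<close>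
  with the next larger \<open>\<rho>\<^sup>k H\<close>.\<close>

lemma geometric_to_power_decay:
  fixes \<phi> :: "real \<Rightarrow> real"
  assumes mono: "\<And>s t. s \<le> t \<Longrightarrow> \<phi> s \<le> \<phi> t" and bound: "\<And>s. \<phi> s \<le> V" and V: "0 \<le> V"
    and \<rho>: "0 < \<rho>" "\<rho> < 1" and \<theta>: "0 < \<theta>" "\<theta> < 1" and K: "1 \<le> K" and H: "0 < H"
    and geo: "\<And>k. \<phi> (\<rho> ^ k * H) \<le> K * \<theta> ^ k * V" and s: "0 < s"
  shows "\<phi> s \<le> K / \<theta> * (s / H) powr (ln \<theta> / ln \<rho>) * V"
proof -
  let ?\<beta> = "ln \<theta> / ln \<rho>"
  have \<beta>: "0 < ?\<beta>" using \<rho> \<theta> by (simp add: divide_neg_neg)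
  have \<rho>\<beta>: "\<rho> powr ?\<beta> = \<theta>" using \<rho> \<theta> by (simp add: powr_def)
  show ?thesis
  proof (cases "H \<le> s")
    case True
    have "1 \<le> K / \<theta>" using K \<theta> by (simp add: field_simps)
    moreover have "1 \<le> (s / H) powr ?\<beta>" using True H \<beta> by (intro ge_one_powr_ge_zero) auto
    ultimately have "1 * 1 \<le> K / \<theta> * (s / H) powr ?\<beta>" by (intro mult_mono) auto
    then have "1 * V \<le> K / \<theta> * (s / H) powr ?\<beta> * V" using V by (intro mult_right_mono) auto
    then show ?thesis using bound[of s] by simp
  next
    case False
    have ex: "\<exists>m. \<rho> ^ m * H \<le> s"
    proof -
      obtain m where "\<rho> ^ m < s / H" using real_arch_pow_inv[of "s / H" \<rho>] s H \<rho> by auto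
      then show ?thesis using H by (intro exI[of _ m]) (simp add: field_simps)
    qed
    define m where "m = (LEAST m. \<rho> ^ m * H \<le> s)"
    have m: "\<rho> ^ m * H \<le> s" unfolding m_def using ex by (rule LeastI_ex)
    have "m \<noteq> 0" using m False by (intro notI) simp
    then obtain k where k: "m = Suc k" by (cases m) auto
    have "\<not> \<rho> ^ k * H \<le> s" using not_less_Least[of k "\<lambda>m. \<rho> ^ m * H \<le> s"] k by (simp add: m_def)
    then have "\<phi> s \<le> \<phi> (\<rho> ^ k * H)" by (intro mono) simp
    also have "\<dots> \<le> K * \<theta> ^ k * V" by (rule geo)
    also have "\<dots> = K / \<theta> * \<theta> ^ m * V" using \<theta> by (simp add: k)
    also have "\<dots> \<le> K / \<theta> * (s / H) powr ?\<beta> * V"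
    proof (intro mult_right_mono mult_left_mono)
      have "\<theta> ^ m = (\<rho> powr ?\<beta>) powr real m" using \<theta> by (simp add: \<rho>\<beta> powr_realpow)
      also have "\<dots> = (\<rho> powr real m) powr ?\<beta>" by (simp add: powr_powr mult.commute)
      also have "\<dots> = (\<rho> ^ m) powr ?\<beta>" using \<rho> by (simp add: powr_realpow)
      also have "\<dots> \<le> (s / H) powr ?\<beta>"
        using m H \<beta> \<rho> by (intro powr_mono2) (auto simp: field_simps)
      finally show "\<theta> ^ m \<le> (s / H) powr ?\<beta>" .
    qed (use K \<theta> V in auto)
    finally show ?thesis .
  qed
qed

text \<open>The discrete form of Gehring's argument: if \<open>S k\<close> is the tail starting with \<open>u k\<close>, then
  \<open>S (k + 1) \<le> K (S k - S (k + 1))\<close>, hence \<open>S (k + 1) \<le> K / (1 + K) S k\<close>.\<close>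

lemma tail_bound_imp_geometric:
  fixes u :: "nat \<Rightarrow> real"
  assumes u: "\<And>k. 0 \<le> u k" and K: "0 < K" and tail: "\<And>k N. sum u {Suc k..N} \<le> K * u k"
  shows "u k \<le> (1 + K) * (K / (1 + K)) ^ k * u 0"
proof -
  have sb: "(\<Sum>i<N. u (i + Suc k)) \<le> K * u k" for k N
  proof -
    have "(\<Sum>i<N. u (i + Suc k)) = sum u {0 + Suc k..<N + Suc k}"
      by (simp only: sum.shift_bounds_nat_ivl lessThan_atLeast0)
    also have "\<dots> = sum u {Suc k..N + k}" by (rule sum.cong) auto
    finally show ?thesis using tail[of k "N + k"] by simp
  qed
  have sm: "summable (\<lambda>i. u (i + Suc 0))" by (rule summableI_nonneg_bounded[OF _ sb]) (rule u)
  then have sm: "summable u" using summable_iff_shift[of u "Suc 0"] by simp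
  have smk: "summable (\<lambda>i. u (i + k))" for k using sm by (simp add: summable_iff_shift)
  define S where "S k = (\<Sum>i. u (i + k))" for k
  have S1: "S (Suc k) \<le> K * u k" for k
    unfolding S_def by (rule suminf_le_const[OF smk sb])
  have S2: "S k = u k + S (Suc k)" for k
    using suminf_split_head[OF smk[of k]] by (simp add: S_def)
  have S0: "0 \<le> S k" for k unfolding S_def by (intro suminf_nonneg smk u)
  have "S (Suc k) \<le> K / (1 + K) * S k" for k
    using S1[of k] S2[of k] K by (simp add: field_simps)
  have "S k \<le> (K / (1 + K)) ^ k * S 0"
  proof (induction k)
    case (Suc k)
    have "S (Suc k) \<le> K / (1 + K) * S k" by fact
    also have "\<dots> \<le> K / (1 + K) * ((K / (1 + K)) ^ k * S 0)" using K Suc by (intro mult_left_mono) auto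
    finally show ?case by (simp add: mult_ac)
  qed simp
  also have "\<dots> \<le> (K / (1 + K)) ^ k * ((1 + K) * u 0)"
    using S1[of 0] S2[of 0] K by (intro mult_left_mono) (auto simp: algebra_simps)
  finally show ?thesis using S2[of k] S0[of "Suc k"] by (simp add: mult_ac)
qed

lemma geometric_sum_le_last:
  fixes v :: "nat \<Rightarrow> real"
  assumes q: "0 < q" "q < 1" and v: "\<And>i. v i = q * v (Suc i)" "\<And>i. 0 \<le> v i"
  shows "sum v {k..N} \<le> v N / (1 - q)"
proof (cases "k \<le> N")
  case True
  then show ?thesis
  proof (induction N rule: dec_induct)
    case base
    show ?case using q v(2)[of k] by (simp add: field_simps mult_left_le)
  next
    case (step N)
    have "sum v {k..Suc N} = sum v {k..N} + v (Suc N)" using step by simp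
    also have "\<dots> \<le> v N / (1 - q) + v (Suc N)" using step by simp
    also have "\<dots> = v (Suc N) / (1 - q)" using q by (simp add: v(1)[of N] field_simps)
    finally show ?case .
  qed
next
  case False
  then show ?thesis using q v(2) by simp
qed

text \<open>Only the layers \<open>\<rho>\<^sup>i H\<close> above \<open>t\<close> contribute, and their powers form a geometric series dominated by
  the last one.\<close>

lemma layer_sum_le_power:
  assumes \<rho>: "0 < \<rho>" "\<rho> < 1" and \<alpha>: "0 < \<alpha>" and H: "0 < (H::real)" and t: "0 < t"
  shows "(\<Sum>i\<in>{k..N}. (\<rho> ^ i * H) powr - \<alpha> * (if t < \<rho> ^ i * H then 1 else 0))
     \<le> 1 / (1 - \<rho> powr \<alpha>) * t powr - \<alpha>"
proof -
  have q: "0 < \<rho> powr \<alpha>" "\<rho> powr \<alpha> < 1"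
    using \<rho> powr_less_mono2[of \<alpha> \<rho> 1] \<alpha> by auto
  define v where "v i = (\<rho> ^ i * H) powr - \<alpha>" for i
  have v: "v i = \<rho> powr \<alpha> * v (Suc i)" for i
    using \<rho> H by (simp add: v_def powr_mult powr_minus field_simps)
  have v0: "0 \<le> v i" for i by (simp add: v_def)
  have all: "(\<Sum>i\<in>{k..N}. v i * (if t < \<rho> ^ i * H then 1 else 0)) \<le> 1 / (1 - \<rho> powr \<alpha>) * t powr - \<alpha>"
    if tN: "t < \<rho> ^ N * H" for N
  proof -
    have "(\<Sum>i\<in>{k..N}. v i * (if t < \<rho> ^ i * H then 1 else 0)) \<le> sum v {k..N}"
      by (rule sum_mono) (simp add: v0)
    also have "\<dots> \<le> v N / (1 - \<rho> powr \<alpha>)" by (rule geometric_sum_le_last[where v = v]) (fact q v v0)+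
    also have "\<dots> \<le> t powr - \<alpha> / (1 - \<rho> powr \<alpha>)"
      unfolding v_def using tN t \<alpha> q by (intro divide_right_mono powr_mono2') auto
    finally show ?thesis by simp
  qed
  show ?thesis
  proof (induction N)
    case 0
    show ?case
    proof (cases "t < \<rho> ^ 0 * H")
      case True
      from all[OF this] show ?thesis by (simp add: v_def)
    next
      case False
      then show ?thesis using q by (cases "k = 0") auto
    qed
  next
    case (Suc N)
    show ?case
    proof (cases "t < \<rho> ^ Suc N * H")
      case True
      from all[OF this] show ?thesis by (simp only: v_def)
    next
      case False
      then show ?thesis using Suc q by (cases "k \<le> Suc N") auto
    qed
  qed
qed

section \<open>Decay from spread, and the gain in the exponent\<close>

context spread_distance
begin

abbreviation sublevel_vol :: "real ^ 'n \<Rightarrow> real \<Rightarrow> real \<Rightarrow> real" where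
  "sublevel_vol a l s \<equiv> measure lebesgue (hcube a l \<inter> {x. infdist x E < s})"

lemma sublevel_vol_mono: "0 < l \<Longrightarrow> s \<le> t \<Longrightarrow> sublevel_vol a l s \<le> sublevel_vol a l t"
  by (rule measure_mono_fmeasurable[OF _ fmeasurableD cube_sublevel_lmeasurable])
    (auto simp: cube_sublevel_lmeasurable)

lemma sublevel_vol_le: "0 < l \<Longrightarrow> sublevel_vol a l s \<le> l ^ CARD('n)"
  using measure_mono_fmeasurable[OF _ fmeasurableD[OF cube_sublevel_lmeasurable[of l a E s]] hcube_lmeasurable[of l a]]
  by (auto simp only: measure_hcube Int_lower1)

lemma sublevel_vol_below_spread:
  assumes l: "0 < l" and y: "y \<in> hcube a l" and t: "t \<le> \<delta> * infdist y E"
  shows "sublevel_vol a l t \<le> (1 - c) * l ^ CARD('n)"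
proof -
  let ?D = "{x \<in> hcube a l. \<delta> * infdist y E \<le> infdist x E}"
  have "sublevel_vol a l t \<le> measure lebesgue (hcube a l - ?D)"
    by (rule measure_mono_fmeasurable)
      (use t l in \<open>auto intro!: fmeasurableD[OF cube_sublevel_lmeasurable] fmeasurable.Diff hcube_lmeasurable superlevel_lmeasurable
        simp: superlevel_measurable\<close>)
  also have "\<dots> = l ^ CARD('n) - measure lebesgue ?D"
    using measurable_measure_Diff[OF hcube_lmeasurable[OF l, of a] superlevel_measurable[of a l "\<delta> * infdist y E" E]]
    by (auto simp only: measure_hcube[OF l])
  also have "\<dots> \<le> (1 - c) * l ^ CARD('n)" using spread[OF l y] by (simp add: algebra_simps)
  finally show ?thesis .
qed

text \<open>Localise the indicator of the set where the distance is below \<open>\<delta> \<eta> s\<close>: in a cube that has a point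
  at distance \<open>\<eta> s\<close>, spread leaves it at most the proportion \<open>1 - c\<close>. Hence the sublevel volume at
  \<open>\<rho> t\<close> is at most \<open>1 - c\<close> times the one at \<open>t\<close>, for \<open>t = 2 (1 + n) s\<close>.\<close>

proposition sublevel_decay_pos: "\<exists>\<beta>>0. sublevel_decay E \<beta>"
proof -
  let ?L = "1 + real CARD('n)"
  obtain \<eta> where eta: "0 < \<eta>" "\<eta> \<le> 1" and
    dbl: "\<And>a l y S. 0 < l \<Longrightarrow> y \<in> hcube a l \<Longrightarrow> \<exists>x\<in>half_cube a l S. \<eta> * infdist y E \<le> infdist x E"
    using doubling by blast
  define \<rho> where "\<rho> = \<delta> * \<eta> / (2 * ?L)"
  have L: "1 \<le> ?L" by simp
  have "\<delta> * \<eta> \<le> \<delta>" using \<delta> eta by (intro mult_left_le) auto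
  then have de: "\<delta> * \<eta> < 1" "\<delta> * \<eta> \<le> 1" using \<delta> by linarith+
  have de0: "0 < \<delta> * \<eta>" using \<delta> eta by simp
  have \<rho>: "0 < \<rho>" "\<rho> < 1"
    using de de0 L by (auto simp: \<rho>_def intro!: divide_pos_pos)
  have contract: "sublevel_vol a l (\<rho> * t) \<le> (1 - c) * sublevel_vol a l t"
    if l: "0 < l" and y: "y \<in> hcube a l" and t: "0 < t" "t \<le> infdist y E" for a l y t
  proof -
    define s where "s = t / (2 * ?L)"
    have s: "0 < s" "s \<le> t" "2 * ?L * s = t" "\<delta> * \<eta> * s = \<rho> * t"
      using t L by (auto simp: s_def \<rho>_def field_simps)
    let ?f = "\<lambda>x :: real ^ 'n. indicator {x. infdist x E < \<rho> * t} x :: ennreal"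
    have "\<delta> * \<eta> * s \<le> s" using de de0 s by (intro mult_left_le_one_le) auto
    then have le: "\<rho> * t \<le> s" using s by simp
    have int: "(\<integral>\<^sup>+x\<in>hcube b m. ?f x \<partial>lebesgue) = ennreal (sublevel_vol b m (\<rho> * t))" if "0 < m" for b m
      unfolding emeasure_cube_sublevel[OF that]
      by (rule nn_integral_cong) (auto simp: indicator_def)
    have "ennreal (sublevel_vol a l (\<rho> * t)) =
        (\<integral>\<^sup>+x\<in>hcube a l. ?f x * indicator {x. infdist x E < s} x \<partial>lebesgue)"
      unfolding int[OF l, symmetric]
      by (rule nn_integral_cong) (use le in \<open>auto simp: indicator_def\<close>)
    also have "\<dots> \<le> ennreal (1 - c) * ennreal (sublevel_vol a l (2 * ?L * s))"
    proof (rule local_to_global[OF eta dbl])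
      show "?f \<in> borel_measurable lebesgue" by (intro borel_measurable_indicator sublevel_lebesgue)
      show "\<exists>y\<in>hcube a l. \<eta> * s \<le> infdist y E"
      proof -
        have "\<eta> * s \<le> s" using s(1) eta by (intro mult_left_le_one_le) auto
        then have "\<eta> * s \<le> infdist y E" using s(2) t by linarith
        with y show ?thesis by blast
      qed
      fix b :: "real ^ 'n" and m y assume m: "0 < m" and y: "y \<in> hcube b m" and ys: "\<eta> * s \<le> infdist y E"
      have "\<delta> * (\<eta> * s) \<le> \<delta> * infdist y E" using ys \<delta> by (intro mult_left_mono) auto
      then have "\<rho> * t \<le> \<delta> * infdist y E" using s by (simp add: mult.assoc)
      from sublevel_vol_below_spread[OF m y this]
      show "(\<integral>\<^sup>+x\<in>hcube b m. ?f x \<partial>lebesgue) \<le> ennreal (1 - c) * ennreal (m ^ CARD('n))"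
        unfolding int[OF m] using c m by (subst ennreal_mult[symmetric]) (auto intro: ennreal_leI)
    qed (use s l in auto)
    finally have "ennreal (sublevel_vol a l (\<rho> * t)) \<le> ennreal ((1 - c) * sublevel_vol a l t)"
      using c s by (simp add: ennreal_mult)
    then show ?thesis using c by (subst (asm) ennreal_le_iff) auto
  qed
  have geo: "sublevel_vol a l (\<rho> ^ k * infdist y E) \<le> (1 - c) ^ k * l ^ CARD('n)"
    if l: "0 < l" and y: "y \<in> hcube a l" and d: "0 < infdist y E" for a l y k
  proof (induction k)
    case 0
    show ?case using sublevel_vol_le[OF l] by simp
  next
    case (Suc k)
    have "\<rho> ^ k * infdist y E \<le> infdist y E"
      using \<rho> d by (intro mult_left_le_one_le) (auto intro: power_le_one)
    then have "sublevel_vol a l (\<rho> * (\<rho> ^ k * infdist y E)) \<le> (1 - c) * sublevel_vol a l (\<rho> ^ k * infdist y E)"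
      using l y d \<rho> by (intro contract) auto
    also have "\<dots> \<le> (1 - c) * ((1 - c) ^ k * l ^ CARD('n))" using Suc c by (intro mult_left_mono) auto
    finally show ?case by (simp add: mult_ac)
  qed
  have "0 < ln (1 - c) / ln \<rho>" using \<rho> c by (simp add: divide_neg_neg)
  moreover have "sublevel_decay E (ln (1 - c) / ln \<rho>)"
    unfolding sublevel_decay_def
  proof (intro exI[of _ "1 / (1 - c)"] conjI allI impI)
    fix a y :: "real ^ 'n" and l s :: real
    assume l: "0 < l" and y: "y \<in> hcube a l" and d: "0 < infdist y E" and s: "0 < s"
    show "sublevel_vol a l s \<le> 1 / (1 - c) * (s / infdist y E) powr (ln (1 - c) / ln \<rho>) * l ^ CARD('n)"
      using l c \<rho> d s geo[OF l y d]
      by (intro geometric_to_power_decay[where \<phi> = "sublevel_vol a l"] sublevel_vol_mono sublevel_vol_le) auto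
  qed (use c in auto)
  ultimately show ?thesis by blast
qed

text \<open>Localise the weight itself. With \<open>s\<^sub>k = \<rho>\<^sup>k H\<close> and \<open>\<rho> = 1 / (2 (1 + n))\<close>, its integral over the
  set below \<open>s\<close> at \<open>s = s\<^sub>k\<^sub>+\<^sub>1\<close> is at most a multiple of \<open>u\<^sub>k = s\<^sub>k\<^sup>-\<^sup>\<alpha> |{d < s\<^sub>k}|\<close>, because
  \<open>2 (1 + n) s\<^sub>k\<^sub>+\<^sub>1 = s\<^sub>k\<close>. By \<open>layer_sum_le_power\<close> the same integral dominates the sum of all
  later \<open>u\<^sub>i\<close>. So \<open>u\<close> decays like some \<open>\<theta>\<^sup>k\<close> and the volumes decay like \<open>(\<rho>\<^sup>\<alpha> \<theta>)\<^sup>k\<close>; the factor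
  \<open>\<theta> < 1\<close> is the gain over \<open>\<alpha>\<close>.\<close>

proposition weight_bound_improves:
  assumes \<alpha>: "0 < \<alpha>" and wb: "weight_bound E \<alpha>"
  shows "\<exists>\<beta>>\<alpha>. sublevel_decay E \<beta>"
proof -
  let ?L = "1 + real CARD('n)"
  obtain \<eta> where eta: "0 < \<eta>" "\<eta> \<le> 1" and
    dbl: "\<And>a l y S. 0 < l \<Longrightarrow> y \<in> hcube a l \<Longrightarrow> \<exists>x\<in>half_cube a l S. \<eta> * infdist y E \<le> infdist x E"
    using doubling by blast
  obtain C where C: "0 < C" and wbC: "\<And>a l y. 0 < l \<Longrightarrow> y \<in> hcube a l \<Longrightarrow> 0 < infdist y E \<Longrightarrow>
     (\<integral>\<^sup>+x\<in>hcube a l. dist_weight E \<alpha> x \<partial>lebesgue) \<le> ennreal (C * infdist y E powr - \<alpha> * l ^ CARD('n))"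
    using wb unfolding weight_bound_def by blast
  define \<rho> where "\<rho> = 1 / (2 * ?L)"
  have L: "1 \<le> ?L" by simp
  have \<rho>: "0 < \<rho>" "\<rho> < 1" "2 * ?L * \<rho> = 1" using L by (auto simp: \<rho>_def)
  have q: "0 < \<rho> powr \<alpha>" "\<rho> powr \<alpha> < 1"
    using \<rho> powr_less_mono2[of \<alpha> \<rho> 1] \<alpha> by auto
  define G where "G = 1 / (1 - \<rho> powr \<alpha>)"
  have G: "0 < G" using q by (simp add: G_def)
  define K where "K = G * C * (\<eta> * \<rho>) powr - \<alpha>"
  have K: "0 < K" using G C eta \<rho> by (simp add: K_def)
  define \<theta> where "\<theta> = K / (1 + K)"
  have \<theta>: "0 < \<theta>" "\<theta> < 1" using K by (auto simp: \<theta>_def)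
  have main: "sublevel_vol a l (\<rho> ^ k * H) \<le> (1 + K) * (\<rho> powr \<alpha> * \<theta>) ^ k * l ^ CARD('n)"
    if l: "0 < l" and y: "y \<in> hcube a l" and H: "0 < H" "H = infdist y E" for a l y k H
  proof -
    define s where "s i = \<rho> ^ i * H" for i :: nat
    have s: "0 < s i" "s i \<le> H" for i
      using \<rho> H by (auto simp: s_def intro!: mult_left_le_one_le power_le_one)
    have sS: "s (Suc i) = \<rho> * s i" for i by (simp add: s_def)
    have s_mono: "s j \<le> s i" if "i \<le> j" for i j
      using \<rho> H that by (auto simp: s_def intro!: mult_right_mono power_decreasing)
    define u where "u i = s i powr - \<alpha> * sublevel_vol a l (s i)" for i
    have u: "0 \<le> u i" for i by (simp add: u_def)
    have layers: "(\<Sum>i\<in>{Suc k..N}. ennreal (s i powr - \<alpha>) * indicator (hcube a l \<inter> {x. infdist x E < s i}) x)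
        \<le> ennreal G * (dist_weight E \<alpha> x * indicator {x. infdist x E < s (Suc k)} x * indicator (hcube a l) x)"
      (is "?lhs \<le> _") for k N x
    proof (cases "x \<in> hcube a l \<and> infdist x E < s (Suc k)")
      case False
      have "?lhs = 0"
        using False s_mono by (intro sum.neutral) (fastforce simp: indicator_def)
      then show ?thesis by simp
    next
      case True
      show ?thesis
      proof (cases "infdist x E = 0")
        case True
        then show ?thesis using \<open>x \<in> hcube a l \<and> _\<close> G \<alpha> by (simp add: dist_weight_cases ennreal_mult_top)
      next
        case False
        then have d: "0 < infdist x E" using infdist_nonneg[of x E] by simp
        have "?lhs = ennreal (\<Sum>i\<in>{Suc k..N}. (\<rho> ^ i * H) powr - \<alpha> * (if infdist x E < \<rho> ^ i * H then 1 else 0))"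
        proof (subst sum_ennreal[symmetric])
          show "?lhs = (\<Sum>i\<in>{Suc k..N}. ennreal ((\<rho> ^ i * H) powr - \<alpha> * (if infdist x E < \<rho> ^ i * H then 1 else 0)))"
            by (rule sum.cong) (use True in \<open>auto simp: indicator_def s_def\<close>)
        qed auto
        also have "\<dots> \<le> ennreal (G * infdist x E powr - \<alpha>)"
          unfolding G_def by (intro ennreal_leI layer_sum_le_power \<rho> \<alpha> H d)
        also have "\<dots> = ennreal G * dist_weight E \<alpha> x" using d G by (simp add: dist_weight_pos ennreal_mult)
        finally show ?thesis using True by simp
      qed
    qed
    have tail: "sum u {Suc k..N} \<le> K * u k" for k N
    proof -
      have "ennreal (sum u {Suc k..N}) = (\<Sum>i\<in>{Suc k..N}. ennreal (u i))"
        using u by (simp add: sum_ennreal)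
      also have "\<dots> = (\<Sum>i\<in>{Suc k..N}. \<integral>\<^sup>+x. ennreal (s i powr - \<alpha>) * indicator (hcube a l \<inter> {x. infdist x E < s i}) x \<partial>lebesgue)"
      proof (rule sum.cong[OF refl])
        fix i
        show "ennreal (u i) = (\<integral>\<^sup>+x. ennreal (s i powr - \<alpha>) * indicator (hcube a l \<inter> {x. infdist x E < s i}) x \<partial>lebesgue)"
        proof -
          have "ennreal (u i) = ennreal (s i powr - \<alpha>) * ennreal (sublevel_vol a l (s i))"
            unfolding u_def by (rule ennreal_mult) auto
          also have "\<dots> = ennreal (s i powr - \<alpha>) *
              (\<integral>\<^sup>+x. indicator (hcube a l \<inter> {x. infdist x E < s i}) x \<partial>lebesgue)"
            by (simp only: emeasure_cube_sublevel[OF l])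
          also have "\<dots> = (\<integral>\<^sup>+x. ennreal (s i powr - \<alpha>) *
              indicator (hcube a l \<inter> {x. infdist x E < s i}) x \<partial>lebesgue)"
            by (rule nn_integral_cmult[symmetric])
              (intro borel_measurable_indicator sets.Int hcube_lebesgue sublevel_lebesgue)
          finally show ?thesis .
        qed
      qed
      also have "\<dots> = (\<integral>\<^sup>+x. (\<Sum>i\<in>{Suc k..N}. ennreal (s i powr - \<alpha>) * indicator (hcube a l \<inter> {x. infdist x E < s i}) x) \<partial>lebesgue)"
        by (rule nn_integral_sum[symmetric])
          (intro borel_measurable_times_ennreal borel_measurable_const borel_measurable_indicator sets.Int hcube_lebesgue sublevel_lebesgue)
      also have "\<dots> \<le> (\<integral>\<^sup>+x. ennreal G * (dist_weight E \<alpha> x * indicator {x. infdist x E < s (Suc k)} x * indicator (hcube a l) x) \<partial>lebesgue)"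
        by (intro nn_integral_mono layers)
      also have "\<dots> = ennreal G * (\<integral>\<^sup>+x\<in>hcube a l. dist_weight E \<alpha> x * indicator {x. infdist x E < s (Suc k)} x \<partial>lebesgue)"
        by (rule nn_integral_cmult)
          (intro borel_measurable_times_ennreal borel_measurable_indicator dist_weight_measurable hcube_lebesgue sublevel_lebesgue)
      also have "\<dots> \<le> ennreal G * (ennreal (C * (\<eta> * s (Suc k)) powr - \<alpha>) * ennreal (sublevel_vol a l (2 * ?L * s (Suc k))))"
      proof (intro mult_left_mono local_to_global[OF eta dbl])
        show "\<exists>y\<in>hcube a l. \<eta> * s (Suc k) \<le> infdist y E"
        proof -
          have "\<eta> * s (Suc k) \<le> s (Suc k)" using s(1)[of "Suc k"] eta by (intro mult_left_le_one_le) auto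
          then have "\<eta> * s (Suc k) \<le> infdist y E" using s(2)[of "Suc k"] H by linarith
          with y show ?thesis by blast
        qed
        fix b :: "real ^ 'n" and m z
        assume m: "0 < m" and z: "z \<in> hcube b m" and zs: "\<eta> * s (Suc k) \<le> infdist z E"
        have pos: "0 < \<eta> * s (Suc k)" using eta s by simp
        have "(\<integral>\<^sup>+x\<in>hcube b m. dist_weight E \<alpha> x \<partial>lebesgue) \<le> ennreal (C * infdist z E powr - \<alpha> * m ^ CARD('n))"
          using wbC[OF m z] pos zs by simp
        also have "\<dots> \<le> ennreal (C * (\<eta> * s (Suc k)) powr - \<alpha> * m ^ CARD('n))"
          using C m pos zs \<alpha> by (intro ennreal_leI mult_right_mono mult_left_mono powr_mono2') auto
        finally show "(\<integral>\<^sup>+x\<in>hcube b m. dist_weight E \<alpha> x \<partial>lebesgue)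
            \<le> ennreal (C * (\<eta> * s (Suc k)) powr - \<alpha>) * ennreal (m ^ CARD('n))"
          using C m by (simp add: ennreal_mult)
      qed (use s l dist_weight_measurable in auto)
      also have "2 * ?L * s (Suc k) = s k" using \<rho>(3) by (simp add: sS mult.assoc[symmetric])
      also have "(\<eta> * s (Suc k)) powr - \<alpha> = (\<eta> * \<rho>) powr - \<alpha> * s k powr - \<alpha>"
        using eta \<rho> s[of k] by (simp add: sS powr_mult mult.assoc)
      also have "ennreal G * (ennreal (C * ((\<eta> * \<rho>) powr - \<alpha> * s k powr - \<alpha>)) * ennreal (sublevel_vol a l (s k)))
          = ennreal (K * u k)"
        using G C by (simp add: K_def u_def ennreal_mult[symmetric] mult_ac)
      finally show ?thesis using K u by (subst (asm) ennreal_le_iff) auto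
    qed
    have "sublevel_vol a l (s k) = s k powr \<alpha> * u k"
      using s[of k] by (simp add: u_def powr_minus)
    also have "\<dots> \<le> s k powr \<alpha> * ((1 + K) * \<theta> ^ k * u 0)"
      using tail_bound_imp_geometric[of u K k, OF u K tail] by (intro mult_left_mono) (auto simp: \<theta>_def)
    also have "\<dots> \<le> s k powr \<alpha> * ((1 + K) * \<theta> ^ k * (H powr - \<alpha> * l ^ CARD('n)))"
      using K \<theta> sublevel_vol_le[OF l, of a H]
      by (intro mult_left_mono) (auto simp: u_def s_def intro!: mult_left_mono)
    also have "s k powr \<alpha> = (\<rho> powr \<alpha>) ^ k * H powr \<alpha>"
      using \<rho> H by (simp add: s_def powr_mult powr_powr powr_realpow[symmetric] mult.commute)
    also have "(\<rho> powr \<alpha>) ^ k * H powr \<alpha> * ((1 + K) * \<theta> ^ k * (H powr - \<alpha> * l ^ CARD('n)))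
        = (1 + K) * (\<rho> powr \<alpha> * \<theta>) ^ k * l ^ CARD('n)"
      using H by (simp add: powr_minus power_mult_distrib field_simps)
    finally show ?thesis by (simp add: s_def)
  qed
  let ?\<beta> = "ln (\<rho> powr \<alpha> * \<theta>) / ln \<rho>"
  have "ln (\<rho> powr \<alpha> * \<theta>) = \<alpha> * ln \<rho> + ln \<theta>"
    using \<rho> \<theta> by (simp add: ln_mult ln_powr)
  then have "?\<beta> = \<alpha> + ln \<theta> / ln \<rho>" using \<rho> by (simp add: add_divide_distrib)
  moreover have "0 < ln \<theta> / ln \<rho>" using \<rho> \<theta> by (simp add: divide_neg_neg)
  ultimately have "\<alpha> < ?\<beta>" by linarith
  moreover have "sublevel_decay E ?\<beta>"
    unfolding sublevel_decay_def
  proof (intro exI[of _ "(1 + K) / (\<rho> powr \<alpha> * \<theta>)"] conjI allI impI)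
    fix a y :: "real ^ 'n" and l s :: real
    assume l: "0 < l" and y: "y \<in> hcube a l" and d: "0 < infdist y E" and s: "0 < s"
    have "\<rho> powr \<alpha> * \<theta> < 1" using q \<theta> mult_strict_mono[of "\<rho> powr \<alpha>" 1 \<theta> 1] by simp
    then show "sublevel_vol a l s \<le> (1 + K) / (\<rho> powr \<alpha> * \<theta>) * (s / infdist y E) powr ?\<beta> * l ^ CARD('n)"
      using l K \<rho> \<theta> d s q main[OF l y d refl]
      by (intro geometric_to_power_decay[where \<phi> = "sublevel_vol a l"] sublevel_vol_mono sublevel_vol_le) auto
  qed (use K q \<theta> in auto)
  ultimately show ?thesis by blast
qed

end

section \<open>Holes and admissible exponents\<close>

lemma infdist_ge_free_ball:
  assumes "E \<noteq> {}" "ball y t \<inter> E = {}"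
  shows "t \<le> infdist y E"
  unfolding infdist_notempty[OF assms(1)]
  using assms by (intro cINF_greatest) (auto simp: disjoint_iff not_less)

lemma free_ball_infdist: "ball y (infdist y E) \<inter> E = {}"
  using infdist_le[of _ E y] by (fastforce simp: disjoint_iff)

lemma hole_ge:
  fixes E :: "(real ^ 'n) set"
  assumes t: "0 < t" and sub: "ball y t \<subseteq> ball x R - E"
  shows "t \<le> hole E x R"
proof -
  let ?T = "{t. 0 < t \<and> (\<exists>y \<in> ball x R. ball y t \<subseteq> ball x R - E)}"
  have "y \<in> ball y t" using t by simp
  then have "y \<in> ball x R" using sub by blast
  then have t: "t \<in> ?T" using t sub by blast
  have "s \<le> R" if s: "s \<in> ?T" for s
  proof -
    obtain z where z: "0 < s" "ball z s \<subseteq> ball x R" using s by blast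
    then have "dist z x + s \<le> R" by (simp add: ball_subset_ball_iff)
    then show ?thesis using zero_le_dist[of z x] by linarith
  qed
  then have "bdd_above ?T" by (rule bdd_aboveI)
  then have "t \<le> Sup ?T" using t by (intro cSup_upper)
  moreover have "hole E x R = (if ?T = {} then 0 else Sup ?T)" unfolding hole_def Let_def ..
  moreover have "?T \<noteq> {}" using t by blast
  ultimately show ?thesis by (simp only: if_False)
qed

lemma hole_le:
  fixes E :: "(real ^ 'n) set"
  assumes "0 \<le> R"
  shows "hole E x R \<le> R"
proof -
  let ?T = "{t. 0 < t \<and> (\<exists>y \<in> ball x R. ball y t \<subseteq> ball x R - E)}"
  have "s \<le> R" if s: "s \<in> ?T" for s
  proof -
    obtain z where z: "0 < s" "ball z s \<subseteq> ball x R" using s by blast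
    then have "dist z x + s \<le> R" by (simp add: ball_subset_ball_iff)
    then show ?thesis using zero_le_dist[of z x] by linarith
  qed
  then have "Sup ?T \<le> R" if "?T \<noteq> {}" using that by (intro cSup_least) blast+
  moreover have "hole E x R = (if ?T = {} then 0 else Sup ?T)" unfolding hole_def Let_def ..
  ultimately show ?thesis using assms by (cases "?T = {}") (simp_all only: if_True if_False simp_thms)
qed

lemma less_hole_imp_free_ball:
  assumes "0 < r" "r < hole E x R"
  obtains y t where "y \<in> ball x R" "r < t" "ball y t \<subseteq> ball x R - E"
proof -
  let ?T = "{t. 0 < t \<and> (\<exists>y \<in> ball x R. ball y t \<subseteq> ball x R - E)}"
  have ne: "?T \<noteq> {}" and Sup: "hole E x R = Sup ?T"
    using assms by (auto simp: hole_def Let_def split: if_splits)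
  have "r < Sup ?T" using assms Sup by simp
  from less_cSupD[OF ne this] obtain t where "t \<in> ?T" "r < t" by blast
  then show thesis using that by blast
qed

lemma measure_ball_cart:
  "0 \<le> R \<Longrightarrow> measure lebesgue (ball (x :: real ^ 'n) R) = unit_ball_vol (real CARD('n)) * R ^ CARD('n)"
  using content_ball[of R x] by (simp add: measure_completion)

lemma ball_subset_hcube: "ball x R \<subseteq> hcube (\<chi> i. x $ i - R) (2 * R)"
proof
  fix z assume z: "z \<in> ball x R"
  have "x $ i - R \<le> z $ i \<and> z $ i < x $ i - R + 2 * R" for i
    using z component_le_norm_cart[of "x - z" i] by (auto simp: dist_norm)
  then show "z \<in> hcube (\<chi> i. x $ i - R) (2 * R)" by (simp add: hcube_def)
qed

context spread_distance
begin

lemma hole_pos: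
  assumes R: "0 < R"
  shows "0 < hole E x R"
proof -
  have n: "1 \<le> real CARD('n)" using zero_less_card_finite[where 'a='n] by linarith
  define l where "l = R / (2 * real CARD('n))"
  have l: "0 < l" "real CARD('n) * l = R / 2" using R n by (auto simp: l_def)
  obtain y where y: "y \<in> hcube x l" "0 < infdist y E" using positive[OF l(1)] by blast
  have "dist x y \<le> R / 2" using dist_hcube[OF hcube_corner[OF l(1)] y(1)] l(2) by simp
  define t where "t = min (infdist y E) (R - dist x y)"
  have t: "0 < t" using y R \<open>dist x y \<le> R / 2\<close> by (simp add: t_def)
  have "ball y t \<subseteq> ball x R"
    using t by (simp add: ball_subset_ball_iff t_def dist_commute min_def)
  moreover have "ball y t \<inter> E = {}" using free_ball_infdist[of y E] by (auto simp: t_def)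
  ultimately have "t \<le> hole E x R" using t by (intro hole_ge) auto
  then show ?thesis using t by simp
qed

lemma less_Mu_iff: "ereal \<alpha> < Mu E \<longleftrightarrow> (\<exists>\<beta>>\<alpha>. Mu_admissible E \<beta>)"
  using hole_pos by (auto simp: Mu_def less_SUP_iff)

text \<open>The centre of a ball that nearly realises the hole of \<open>ball x R\<close> is at distance at least half the hole from \<open>E\<close>,
  and it lies in the cube of side \<open>2 R\<close> around \<open>x\<close>.\<close>

lemma decay_imp_admissible:
  assumes "0 < \<beta>" "sublevel_decay E \<beta>"
  shows "Mu_admissible E \<beta>"
proof -
  obtain C where C: "0 < C" and dec: "\<And>a l y s. 0 < l \<Longrightarrow> y \<in> hcube a l \<Longrightarrow> 0 < infdist y E \<Longrightarrow> 0 < s \<Longrightarrow>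
     sublevel_vol a l s \<le> C * (s / infdist y E) powr \<beta> * l ^ CARD('n)"
    using assms(2) unfolding sublevel_decay_def by blast
  define u where "u = unit_ball_vol (real CARD('n))"
  have u: "0 < u" unfolding u_def by simp
  show ?thesis
    unfolding Mu_admissible_def
  proof (intro exI[of _ "C * 2 powr \<beta> * 2 ^ CARD('n) / u"] ballI allI impI)
    fix x r R assume x: "x \<in> E" and rR: "0 < r \<and> r < hole E x R \<and> hole E x R \<le> R"
    define h where "h = hole E x R"
    have h: "0 < h" "h \<le> R" "0 < r" "r < h" using rR by (auto simp: h_def)
    have R: "0 < R" using h by simp
    obtain y t where y: "y \<in> ball x R" "h / 2 < t" "ball y t \<subseteq> ball x R - E"
      using less_hole_imp_free_ball[of "h / 2" E x R] h unfolding h_def by auto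
    have "t \<le> infdist y E" using y(3) by (intro infdist_ge_free_ball nonempty) blast
    then have d: "h / 2 < infdist y E" using y(2) by simp
    let ?a = "\<chi> i. x $ i - R"
    have "measure lebesgue (nbhd E r \<inter> ball x R) \<le> sublevel_vol ?a (2 * R) r"
      using R ball_subset_hcube[of x R]
      by (intro measure_mono_fmeasurable cube_sublevel_lmeasurable)
        (auto simp: nbhd_def intro!: sets.Int sublevel_lebesgue)
    also have "\<dots> \<le> C * (r / infdist y E) powr \<beta> * (2 * R) ^ CARD('n)"
      using y(1) ball_subset_hcube[of x R] d h R by (intro dec) auto
    also have "\<dots> \<le> C * (2 * (r / h)) powr \<beta> * (2 * R) ^ CARD('n)"
    proof (intro mult_right_mono mult_left_mono powr_mono2)
      have "r / infdist y E \<le> r / (h / 2)" using d h by (intro divide_left_mono) auto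
      then show "r / infdist y E \<le> 2 * (r / h)" by (simp add: mult.commute)
    qed (use C R assms h in \<open>auto simp: infdist_nonneg\<close>)
    also have "(2 * (r / h)) powr \<beta> = 2 powr \<beta> * (h / r) powr - \<beta>"
      using h by (simp add: powr_mult powr_divide powr_minus field_simps)
    finally have "measure lebesgue (nbhd E r \<inter> ball x R)
        \<le> C * (2 powr \<beta> * (h / r) powr - \<beta>) * (2 * R) ^ CARD('n)" .
    then have "measure lebesgue (nbhd E r \<inter> ball x R) / (u * R ^ CARD('n))
        \<le> C * (2 powr \<beta> * (h / r) powr - \<beta>) * (2 * R) ^ CARD('n) / (u * R ^ CARD('n))"
      using u R by (intro divide_right_mono) auto
    also have "\<dots> = C * 2 powr \<beta> * 2 ^ CARD('n) / u * (h / r) powr - \<beta>"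
      using R u by (simp add: power_mult_distrib)
    finally show "measure lebesgue (nbhd E r \<inter> ball x R) / measure lebesgue (ball x R)
        \<le> C * 2 powr \<beta> * 2 ^ CARD('n) / u * (hole E x R / r) powr - \<beta>"
      using measure_ball_cart[of R x] R by (simp only: u_def h_def)
  qed
qed

lemma Mu_pos: "0 < Mu E"
proof -
  obtain \<beta> where "0 < \<beta>" "sublevel_decay E \<beta>" using sublevel_decay_pos by blast
  then have "ereal 0 < Mu E" unfolding less_Mu_iff using decay_imp_admissible by blast
  then show ?thesis by (simp add: zero_ereal_def)
qed

lemma weight_bound_imp_less_Mu:
  assumes "0 < \<alpha>" "weight_bound E \<alpha>"
  shows "ereal \<alpha> < Mu E"
proof -
  obtain \<beta> where "\<alpha> < \<beta>" "sublevel_decay E \<beta>" using weight_bound_improves[OF assms] by blast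
  then show ?thesis unfolding less_Mu_iff using decay_imp_admissible[of \<beta>] assms(1) by auto
qed

text \<open>The closure of \<open>E\<close> is a null set, by letting \<open>s\<close> tend to \<open>0\<close> in the decay estimate.\<close>

lemma AE_infdist_pos: "AE x in lebesgue. 0 < infdist x E"
proof -
  obtain \<beta> where \<beta>: "0 < \<beta>" "sublevel_decay E \<beta>" using sublevel_decay_pos by blast
  then obtain C where C: "0 < C" and dec: "\<And>a l y s. 0 < l \<Longrightarrow> y \<in> hcube a l \<Longrightarrow> 0 < infdist y E \<Longrightarrow> 0 < s \<Longrightarrow>
     sublevel_vol a l s \<le> C * (s / infdist y E) powr \<beta> * l ^ CARD('n)"
    unfolding sublevel_decay_def by blast
  have null: "hcube a l \<inter> {x. infdist x E \<le> 0} \<in> null_sets lebesgue" if l: "0 < l" for a l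
  proof -
    let ?Z = "hcube a l \<inter> {x. infdist x E \<le> 0}"
    have Z: "?Z \<in> lmeasurable"
      by (rule fmeasurableI2[OF hcube_lmeasurable[OF l, of a]]) (auto intro!: sets.Int sublevel_lebesgue hcube_lebesgue)
    obtain y where y: "y \<in> hcube a l" "0 < infdist y E" using positive[OF l] by blast
    define K where "K = C * l ^ CARD('n)"
    have K: "0 < K" using C l by (simp add: K_def)
    have le: "measure lebesgue ?Z \<le> K * t" if t: "0 < t" for t
    proof -
      define s where "s = infdist y E * t powr (1 / \<beta>)"
      have s: "0 < s" using y t by (simp add: s_def)
      have "measure lebesgue ?Z \<le> sublevel_vol a l s"
        using s Z by (intro measure_mono_fmeasurable cube_sublevel_lmeasurable l) auto
      also have "\<dots> \<le> C * (s / infdist y E) powr \<beta> * l ^ CARD('n)" by (intro dec l y s)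
      also have "(s / infdist y E) powr \<beta> = t" using y t \<beta> by (simp add: s_def powr_powr)
      finally show ?thesis by (simp add: K_def mult_ac)
    qed
    have "measure lebesgue ?Z = 0"
    proof (rule ccontr)
      assume "measure lebesgue ?Z \<noteq> 0"
      then have pos: "0 < measure lebesgue ?Z" by (simp add: zero_less_measure_iff)
      have "measure lebesgue ?Z \<le> K * (measure lebesgue ?Z / (2 * K))" using pos K by (intro le) simp
      then show False using pos K by simp
    qed
    then have "emeasure lebesgue ?Z = 0" using Z by (simp add: emeasure_eq_measure2)
    then show ?thesis using Z by (intro null_setsI) auto
  qed
  have "(\<Union>k::nat. hcube (\<chi> i. - real (Suc k)) (2 * real (Suc k)) \<inter> {x. infdist x E \<le> 0}) \<in> null_sets lebesgue"
    by (intro null_sets_UN null) simp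
  moreover have "{x \<in> space lebesgue. \<not> 0 < infdist x E} \<subseteq>
      (\<Union>k::nat. hcube (\<chi> i. - real (Suc k)) (2 * real (Suc k)) \<inter> {x. infdist x E \<le> 0})"
  proof
    fix x assume x: "x \<in> {x \<in> space lebesgue. \<not> 0 < infdist x E}"
    obtain k where k: "norm x \<le> real k" using real_arch_simple by blast
    have "x \<in> ball 0 (real (Suc k))" using k by simp
    then have "x \<in> hcube (\<chi> i. - real (Suc k)) (2 * real (Suc k))"
      using ball_subset_hcube[of 0 "real (Suc k)"] by auto
    then show "x \<in> (\<Union>k::nat. hcube (\<chi> i. - real (Suc k)) (2 * real (Suc k)) \<inter> {x. infdist x E \<le> 0})"
      using x by auto
  qed
  ultimately show ?thesis by (rule AE_I')
qed

end

section \<open>Weight bounds below the Muckenhoupt exponent\<close>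

context spread_distance
begin

text \<open>If the distance is below \<open>h\<close>, it lies between \<open>h / 2\<^sup>k\<^sup>+\<^sup>1\<close> and \<open>h / 2\<^sup>k\<close> for some \<open>k\<close>, and the
  \<open>k\<close>-th summand alone suffices.\<close>

lemma dist_weight_le_layers:
  assumes \<beta>: "0 < \<beta>" and h: "0 < h" and d: "0 < infdist x E"
  shows "dist_weight E \<beta> x \<le> ennreal (h powr - \<beta>) +
    (\<Sum>k. ennreal ((h / 2 ^ Suc k) powr - \<beta>) * indicator {x. infdist x E < h / 2 ^ k} x)"
proof (cases "h \<le> infdist x E")
  case True
  then have "infdist x E powr - \<beta> \<le> h powr - \<beta>" using h \<beta> by (intro powr_mono2') auto
  then have "dist_weight E \<beta> x \<le> ennreal (h powr - \<beta>)" using d by (simp add: dist_weight_pos ennreal_leI)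
  then show ?thesis by (rule order_trans) simp
next
  case False
  define f where "f k = ennreal ((h / 2 ^ Suc k) powr - \<beta>) * indicator {x. infdist x E < h / 2 ^ k} x" for k
  have ex: "\<exists>k. h / 2 ^ k \<le> infdist x E"
  proof -
    obtain k where "h / infdist x E < 2 ^ k" using real_arch_pow[of 2 "h / infdist x E"] by auto
    then show ?thesis using d by (intro exI[of _ k]) (simp add: field_simps)
  qed
  define m where "m = (LEAST k. h / 2 ^ k \<le> infdist x E)"
  have m: "h / 2 ^ m \<le> infdist x E" unfolding m_def using ex by (rule LeastI_ex)
  have "m \<noteq> 0" using m False by (intro notI) simp
  then obtain k where k: "m = Suc k" by (cases m) auto
  have "\<not> h / 2 ^ k \<le> infdist x E"
    using not_less_Least[of k "\<lambda>k. h / 2 ^ k \<le> infdist x E"] k by (simp add: m_def)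
  then have fk: "f k = ennreal ((h / 2 ^ Suc k) powr - \<beta>)" by (simp add: f_def)
  have "infdist x E powr - \<beta> \<le> (h / 2 ^ Suc k) powr - \<beta>"
    using m k h \<beta> by (intro powr_mono2') auto
  then have "dist_weight E \<beta> x \<le> f k" using d fk by (simp add: dist_weight_pos ennreal_leI)
  also have "\<dots> \<le> (\<Sum>k. f k)" using sum_le_suminf[of f "{k}"] by simp
  finally show ?thesis unfolding f_def by (rule order_trans) simp
qed

text \<open>The volume of the \<open>k\<close>-th layer decays like \<open>2\<^sup>-\<^sup>\<gamma>\<^sup>k\<close> while the weight on it grows like \<open>2\<^sup>\<beta>\<^sup>k\<close>, so
  the sum over the layers is a geometric series of ratio \<open>q\<close>.\<close>

lemma admissible_ball_bound:
  assumes \<beta>: "0 < \<beta>" "\<beta> < \<gamma>" and adm: "Mu_admissible E \<gamma>"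
  obtains M where "0 < M" "\<And>x R. x \<in> E \<Longrightarrow> 0 < R \<Longrightarrow>
    (\<integral>\<^sup>+z\<in>ball x R. dist_weight E \<beta> z \<partial>lebesgue)
      \<le> ennreal (M * hole E x R powr - \<beta> * measure lebesgue (ball x R))"
proof -
  obtain C0 where C0: "\<And>x r R. x \<in> E \<Longrightarrow> 0 < r \<Longrightarrow> r < hole E x R \<Longrightarrow> hole E x R \<le> R \<Longrightarrow>
        measure lebesgue (nbhd E r \<inter> ball x R) / measure lebesgue (ball x R)
          \<le> C0 * (hole E x R / r) powr (- \<gamma>)"
    using adm unfolding Mu_admissible_def by blast
  \<comment> \<open>Admissibility speaks of radii strictly below the hole; enlarging the constant to at least
    \<open>1\<close> covers the zeroth layer by the trivial bound.\<close>
  define C where "C = max C0 1"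
  define q where "q = 2 powr (\<beta> - \<gamma>)"
  have q: "0 < q" "q < 1" using \<beta> powr_less_mono[of "\<beta> - \<gamma>" 0 2] by (auto simp: q_def)
  define M where "M = 1 + 2 powr \<beta> * C / (1 - q)"
  have C: "1 \<le> C" "C0 \<le> C" by (auto simp: C_def)
  have M: "0 < M" using C q by (auto simp: M_def intro!: add_pos_nonneg)
  have "(\<integral>\<^sup>+z\<in>ball x R. dist_weight E \<beta> z \<partial>lebesgue)
      \<le> ennreal (M * hole E x R powr - \<beta> * measure lebesgue (ball x R))" if x: "x \<in> E" and R: "0 < R" for x R
  proof -
    define h where "h = hole E x R"
    define V where "V = measure lebesgue (ball x R)"
    have h: "0 < h" "h \<le> R" using hole_pos[OF R, of x] hole_le[of R E x] R by (auto simp: h_def)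
    have V: "0 < V" 
      unfolding V_def measure_ball_cart[OF less_imp_le[OF R]] using R by (intro mult_pos_pos) auto
    let ?B = "\<lambda>k::nat. ball x R \<inter> {z. infdist z E < h / 2 ^ k}"
    have Bm: "?B k \<in> lmeasurable" for k
      by (rule fmeasurableI2[OF lmeasurable_ball[of x R]]) (auto intro!: sets.Int sublevel_lebesgue)
    have vol: "measure lebesgue (?B k) \<le> C * 2 powr (- \<gamma> * real k) * V" for k
    proof (cases "k = 0")
      case True
      have "measure lebesgue (?B k) \<le> V" unfolding V_def
        by (intro measure_mono_fmeasurable fmeasurableD[OF Bm]) auto
      also have "\<dots> \<le> C * V" using C V by simp
      finally show ?thesis using True by simp
    next
      case False
      then have "(1::real) < 2 ^ k" by (simp add: one_less_power)
      then have "h / 2 ^ k < h" using h by (simp add: field_simps)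
      then have "measure lebesgue (nbhd E (h / 2 ^ k) \<inter> ball x R) / V \<le> C0 * (h / (h / 2 ^ k)) powr - \<gamma>"
        unfolding V_def h_def using h by (intro C0 x) (auto simp: h_def)
      also have "\<dots> \<le> C * (h / (h / 2 ^ k)) powr - \<gamma>" using C by (intro mult_right_mono) auto
      also have "(h / (h / 2 ^ k)) powr - \<gamma> = 2 powr (- \<gamma> * real k)"
        using h by (simp add: powr_powr powr_realpow[symmetric] mult.commute)
      finally have "measure lebesgue (nbhd E (h / 2 ^ k) \<inter> ball x R) \<le> C * 2 powr (- \<gamma> * real k) * V"
        using V by (simp add: field_simps)
      then show ?thesis by (simp add: nbhd_def Int_commute)
    qed
    have layer: "(\<integral>\<^sup>+z\<in>ball x R. ennreal ((h / 2 ^ Suc k) powr - \<beta>) * indicator {z. infdist z E < h / 2 ^ k} z \<partial>lebesgue)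
        \<le> ennreal (2 powr \<beta> * C * h powr - \<beta> * V * q ^ k)" for k
    proof -
      have hp: "(h / 2 ^ Suc k) powr - \<beta> = h powr - \<beta> * (2 powr (\<beta> * real (Suc k)))"
        using h by (simp only: powr_divide powr_minus powr_realpow[symmetric, of 2] powr_powr) 
          (simp add: field_simps powr_minus)
      have "(\<integral>\<^sup>+z\<in>ball x R. ennreal ((h / 2 ^ Suc k) powr - \<beta>) * indicator {z. infdist z E < h / 2 ^ k} z \<partial>lebesgue)
          = (\<integral>\<^sup>+z. ennreal ((h / 2 ^ Suc k) powr - \<beta>) * indicator (?B k) z \<partial>lebesgue)"
        by (rule nn_integral_cong) (auto simp: indicator_def)
      also have "\<dots> = ennreal ((h / 2 ^ Suc k) powr - \<beta>) * emeasure lebesgue (?B k)"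
        by (rule nn_integral_cmult_indicator) (rule fmeasurableD[OF Bm])
      also have "emeasure lebesgue (?B k) = ennreal (measure lebesgue (?B k))"
        using Bm by (rule emeasure_eq_measure2)
      also have "ennreal ((h / 2 ^ Suc k) powr - \<beta>) * \<dots> = ennreal ((h / 2 ^ Suc k) powr - \<beta> * measure lebesgue (?B k))"
        by (rule ennreal_mult[symmetric]) auto
      also have "\<dots> \<le> ennreal ((h / 2 ^ Suc k) powr - \<beta> * (C * 2 powr (- \<gamma> * real k) * V))"
        by (intro ennreal_leI mult_left_mono vol) auto
      also have "(h / 2 ^ Suc k) powr - \<beta> * (C * 2 powr (- \<gamma> * real k) * V)
          = 2 powr \<beta> * C * h powr - \<beta> * V * q ^ k"
      proof -
        have "q ^ k = 2 powr (\<beta> * real k) * 2 powr (- \<gamma> * real k)"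
          using q by (simp add: q_def powr_realpow[symmetric] powr_powr powr_add[symmetric] algebra_simps)
        moreover have "2 powr (\<beta> * real (Suc k)) = 2 powr \<beta> * 2 powr (\<beta> * real k)"
          by (simp add: powr_add[symmetric] algebra_simps)
        ultimately show ?thesis unfolding hp by (simp add: mult_ac)
      qed
      finally show ?thesis .
    qed
    have "(\<integral>\<^sup>+z\<in>ball x R. dist_weight E \<beta> z \<partial>lebesgue)
        \<le> (\<integral>\<^sup>+z. ennreal (h powr - \<beta>) * indicator (ball x R) z +
          (\<Sum>k. ennreal ((h / 2 ^ Suc k) powr - \<beta>) * indicator {z. infdist z E < h / 2 ^ k} z * indicator (ball x R) z) \<partial>lebesgue)"
    proof (rule nn_integral_mono_AE)
      show "AE z in lebesgue. dist_weight E \<beta> z * indicator (ball x R) z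
          \<le> ennreal (h powr - \<beta>) * indicator (ball x R) z +
          (\<Sum>k. ennreal ((h / 2 ^ Suc k) powr - \<beta>) * indicator {z. infdist z E < h / 2 ^ k} z * indicator (ball x R) z)"
        using AE_infdist_pos
      proof eventually_elim
        case (elim z)
        from dist_weight_le_layers[OF \<beta>(1) h(1) elim] show ?case by (simp add: indicator_def)
      qed
    qed
    also have "\<dots> = (\<integral>\<^sup>+z. ennreal (h powr - \<beta>) * indicator (ball x R) z \<partial>lebesgue) +
          (\<Sum>k. \<integral>\<^sup>+z\<in>ball x R. ennreal ((h / 2 ^ Suc k) powr - \<beta>) * indicator {z. infdist z E < h / 2 ^ k} z \<partial>lebesgue)"
    proof (subst nn_integral_add)
      have ml: "(\<lambda>z. ennreal ((h / 2 ^ Suc k) powr - \<beta>) * indicator {z. infdist z E < h / 2 ^ k} z * indicator (ball x R) z)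
          \<in> borel_measurable lebesgue" for k
        by (intro borel_measurable_times_ennreal borel_measurable_const borel_measurable_indicator sublevel_lebesgue) simp
      then show "(\<lambda>z. \<Sum>k. ennreal ((h / 2 ^ Suc k) powr - \<beta>) * indicator {z. infdist z E < h / 2 ^ k} z * indicator (ball x R) z)
          \<in> borel_measurable lebesgue"
        by (rule borel_measurable_suminf_order)
      show "(\<lambda>z. ennreal (h powr - \<beta>) * indicator (ball x R) z) \<in> borel_measurable lebesgue"
        by (intro borel_measurable_times_ennreal borel_measurable_const borel_measurable_indicator) simp
      show "(\<integral>\<^sup>+z. ennreal (h powr - \<beta>) * indicator (ball x R) z \<partial>lebesgue) +
          (\<integral>\<^sup>+z. (\<Sum>k. ennreal ((h / 2 ^ Suc k) powr - \<beta>) * indicator {z. infdist z E < h / 2 ^ k} z * indicator (ball x R) z) \<partial>lebesgue)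
        = (\<integral>\<^sup>+z. ennreal (h powr - \<beta>) * indicator (ball x R) z \<partial>lebesgue) +
          (\<Sum>k. \<integral>\<^sup>+z\<in>ball x R. ennreal ((h / 2 ^ Suc k) powr - \<beta>) * indicator {z. infdist z E < h / 2 ^ k} z \<partial>lebesgue)"
        by (subst nn_integral_suminf[OF ml]) (rule refl)
    qed
    also have "\<dots> \<le> ennreal (h powr - \<beta> * V) + ennreal (2 powr \<beta> * C * h powr - \<beta> * V * (1 / (1 - q)))"
    proof (rule add_mono)
      have "(\<integral>\<^sup>+z. ennreal (h powr - \<beta>) * indicator (ball x R) z \<partial>lebesgue) = ennreal (h powr - \<beta>) * emeasure lebesgue (ball x R)"
        by (rule nn_integral_cmult_indicator) simp
      also have "emeasure lebesgue (ball x R) = ennreal V"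
        unfolding V_def by (rule emeasure_eq_measure2[OF lmeasurable_ball])
      finally show "(\<integral>\<^sup>+z. ennreal (h powr - \<beta>) * indicator (ball x R) z \<partial>lebesgue) \<le> ennreal (h powr - \<beta> * V)"
        using V by (simp add: ennreal_mult)
      have "(\<Sum>k. \<integral>\<^sup>+z\<in>ball x R. ennreal ((h / 2 ^ Suc k) powr - \<beta>) * indicator {z. infdist z E < h / 2 ^ k} z \<partial>lebesgue)
          \<le> (\<Sum>k. ennreal (2 powr \<beta> * C * h powr - \<beta> * V * q ^ k))"
        by (intro suminf_le layer) auto
      also have "\<dots> = ennreal (2 powr \<beta> * C * h powr - \<beta> * V * (1 / (1 - q)))"
        using C V q by (intro suminf_ennreal_eq sums_mult geometric_sums) auto
      finally show "(\<Sum>k. \<integral>\<^sup>+z\<in>ball x R. ennreal ((h / 2 ^ Suc k) powr - \<beta>) * indicator {z. infdist z E < h / 2 ^ k} z \<partial>lebesgue)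
          \<le> ennreal (2 powr \<beta> * C * h powr - \<beta> * V * (1 / (1 - q)))" .
    qed
    also have "\<dots> = ennreal (h powr - \<beta> * V + 2 powr \<beta> * C * h powr - \<beta> * V * (1 / (1 - q)))"
      using V C q by (intro ennreal_plus[symmetric]) auto
    also have "h powr - \<beta> * V + 2 powr \<beta> * C * h powr - \<beta> * V * (1 / (1 - q)) = M * h powr - \<beta> * V"
      by (simp add: M_def algebra_simps)
    finally show ?thesis by (simp only: V_def h_def)
  qed
  with M that show thesis by blast
qed

text \<open>A cube of side \<open>l\<close> that has a point at distance less than \<open>n l\<close> from \<open>E\<close> lies in a ball of radius
  \<open>4 n l\<close> around a point \<open>e\<close> of \<open>E\<close>, and this radius is large enough for the ball to contain, for each
  \<open>y\<close> in the cube, the free ball around \<open>y\<close> that touches \<open>E\<close>. So the hole is at least the distance of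
  \<open>y\<close>. On any other cube the distances of two points differ at most by a factor two.\<close>

proposition less_Mu_imp_weight_bound:
  assumes "0 < \<beta>" "ereal \<beta> < Mu E"
  shows "weight_bound E \<beta>"
proof -
  obtain \<gamma> where \<gamma>: "\<beta> < \<gamma>" "Mu_admissible E \<gamma>" using assms(2) unfolding less_Mu_iff by blast
  obtain M where M: "0 < M" and ball: "\<And>x R. x \<in> E \<Longrightarrow> 0 < R \<Longrightarrow>
    (\<integral>\<^sup>+z\<in>ball x R. dist_weight E \<beta> z \<partial>lebesgue)
      \<le> ennreal (M * hole E x R powr - \<beta> * measure lebesgue (ball x R))"
    using admissible_ball_bound[OF assms(1) \<gamma>] by blast
  let ?n = "real CARD('n)"
  have n: "0 < ?n" by simp
  define u where "u = unit_ball_vol ?n"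
  have u: "0 < u" unfolding u_def by simp
  define C1 where "C1 = M * u * (4 * ?n) ^ CARD('n)"
  have C1: "0 < C1" using M u n by (simp add: C1_def)
  show ?thesis
    unfolding weight_bound_def
  proof (intro exI[of _ "C1 + 2 powr \<beta>"] conjI allI impI)
    fix a y :: "real ^ 'n" and l :: real
    assume l: "0 < l" and y: "y \<in> hcube a l" and d: "0 < infdist y E"
    show "(\<integral>\<^sup>+x\<in>hcube a l. dist_weight E \<beta> x \<partial>lebesgue)
        \<le> ennreal ((C1 + 2 powr \<beta>) * infdist y E powr - \<beta> * l ^ CARD('n))"
    proof (cases "\<exists>z\<in>hcube a l. infdist z E < ?n * l")
      case True
      then obtain z where z: "z \<in> hcube a l" "infdist z E < ?n * l" by blast
      then have "(INF e\<in>E. dist z e) < ?n * l" using nonempty by (simp add: infdist_notempty)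
      then obtain e where e: "e \<in> E" "dist z e < ?n * l"
        using nonempty by (subst (asm) cINF_less_iff) (auto intro: bdd_belowI[where m=0])
      define R where "R = 4 * ?n * l"
      have R: "0 < R" using n l by (simp add: R_def)
      have de: "dist e w < R / 2" if "w \<in> hcube a l" for w
      proof -
        have "R / 2 = ?n * l + ?n * l" by (simp add: R_def)
        then show ?thesis
          using dist_triangle[of e w z] dist_hcube[OF z(1) that] e(2) dist_commute[of e z] by linarith
      qed
      have sub: "hcube a l \<subseteq> ball e R"
      proof
        fix w assume "w \<in> hcube a l"
        from de[OF this] show "w \<in> ball e R" using R by simp
      qed
      have "ball y (infdist y E) \<subseteq> ball e R"
      proof
        fix w assume "w \<in> ball y (infdist y E)"
        then have "dist y w < infdist y E" by simp
        also have "\<dots> \<le> dist y e" by (rule infdist_le[OF e(1)])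
        finally show "w \<in> ball e R"
          using de[OF y] dist_triangle[of e w y] by (simp add: dist_commute)
      qed
      then have hole: "infdist y E \<le> hole E e R"
        using d free_ball_infdist[of y E] by (intro hole_ge) auto
      have "(\<integral>\<^sup>+x\<in>hcube a l. dist_weight E \<beta> x \<partial>lebesgue) \<le> (\<integral>\<^sup>+x\<in>ball e R. dist_weight E \<beta> x \<partial>lebesgue)"
        using sub by (intro nn_integral_mono) (auto simp: indicator_def)
      also have "\<dots> \<le> ennreal (M * hole E e R powr - \<beta> * measure lebesgue (ball e R))"
        by (rule ball[OF e(1) R])
      also have "\<dots> \<le> ennreal (M * infdist y E powr - \<beta> * measure lebesgue (ball e R))"
        using M d hole assms(1) by (intro ennreal_leI mult_right_mono mult_left_mono powr_mono2') auto
      also have "measure lebesgue (ball e R) = u * (4 * ?n) ^ CARD('n) * l ^ CARD('n)"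
        using measure_ball_cart[of R e] R by (simp add: u_def R_def power_mult_distrib)
      also have "M * infdist y E powr - \<beta> * (u * (4 * ?n) ^ CARD('n) * l ^ CARD('n))
          = C1 * infdist y E powr - \<beta> * l ^ CARD('n)" by (simp add: C1_def)
      also have "ennreal \<dots> \<le> ennreal ((C1 + 2 powr \<beta>) * infdist y E powr - \<beta> * l ^ CARD('n))"
        using l by (intro ennreal_leI mult_right_mono) auto
      finally show ?thesis .
    next
      case False
      then have far: "?n * l \<le> infdist z E" if "z \<in> hcube a l" for z using that by force
      have w: "dist_weight E \<beta> z \<le> ennreal (2 powr \<beta> * infdist y E powr - \<beta>)" if z: "z \<in> hcube a l" for z
      proof -
        have "0 < ?n * l" using n l by simp
        with far[OF z] have dz: "0 < infdist z E" by linarith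
        have "infdist y E / 2 \<le> infdist z E" using infdist_hcube[OF y z, of E] far[OF z] by linarith
        then have "infdist z E powr - \<beta> \<le> (infdist y E / 2) powr - \<beta>"
          using d assms(1) by (intro powr_mono2') auto
        also have "\<dots> = 2 powr \<beta> * infdist y E powr - \<beta>"
          using d by (simp add: powr_divide powr_minus field_simps)
        finally show ?thesis using dz by (simp add: dist_weight_pos ennreal_leI)
      qed
      have "(\<integral>\<^sup>+x\<in>hcube a l. dist_weight E \<beta> x \<partial>lebesgue)
          \<le> (\<integral>\<^sup>+x. ennreal (2 powr \<beta> * infdist y E powr - \<beta>) * indicator (hcube a l) x \<partial>lebesgue)"
        by (rule nn_integral_mono) (auto simp: indicator_def w)
      also have "\<dots> = ennreal (2 powr \<beta> * infdist y E powr - \<beta>) * ennreal (l ^ CARD('n))"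
        by (simp only: nn_integral_cmult_indicator[OF hcube_lebesgue] emeasure_hcube[OF l])
      also have "\<dots> = ennreal (2 powr \<beta> * infdist y E powr - \<beta> * l ^ CARD('n))"
        using l by (intro ennreal_mult[symmetric]) auto
      also have "\<dots> \<le> ennreal ((C1 + 2 powr \<beta>) * infdist y E powr - \<beta> * l ^ CARD('n))"
        using l C1 by (intro ennreal_leI mult_right_mono) auto
      finally show ?thesis .
    qed
  qed (use C1 in \<open>auto intro: add_pos_nonneg\<close>)
qed

end

section \<open>Averages and the Muckenhoupt classes\<close>

lemma epow_mono: "0 < s \<Longrightarrow> x \<le> y \<Longrightarrow> epow x s \<le> epow y s"
  by (auto simp: epow_def top_unique intro!: ennreal_leI powr_mono2 enn2real_mono simp flip: less_top)

lemma epow_ennreal: "0 < x \<Longrightarrow> epow (ennreal x) s = ennreal (x powr s)"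
  by (auto simp: epow_def)

lemma epow_le_imp_le:
  assumes "0 < s" "0 < b" "epow x s \<le> ennreal b"
  shows "x \<le> ennreal (b powr (1 / s))"
proof (cases x)
  case (real r)
  show ?thesis
  proof (cases "r = 0")
    case False
    then have r: "0 < r" using real by simp
    then have "r powr s \<le> b" using assms real by (simp add: epow_ennreal)
    then have "(r powr s) powr (1 / s) \<le> b powr (1 / s)" using assms by (intro powr_mono2) auto
    then show ?thesis using assms r real by (simp add: powr_powr ennreal_leI)
  qed (use real in simp)
next
  case top
  then show ?thesis using assms by (simp add: epow_def top_unique)
qed

lemma dual_dist_weight:
  assumes "1 < p"
  shows "epow (dist_weight E \<alpha> x) (1 / (1 - p)) = dist_weight E (\<alpha> / (1 - p)) x"
proof -
  have p: "1 - p < 0" using assms by simp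
  consider "\<alpha> = 0" | "\<alpha> \<noteq> 0" "infdist x E = 0" | "\<alpha> \<noteq> 0" "0 < infdist x E"
    using infdist_nonneg[of x E] by linarith
  then show ?thesis
  proof cases
    case 1
    then show ?thesis using epow_ennreal[of 1] by (simp add: dist_weight_cases)
  next
    case 2
    then show ?thesis using p
      by (auto simp: dist_weight_cases epow_def zero_less_divide_iff divide_less_0_iff)
  next
    case 3
    then show ?thesis using epow_ennreal[of "infdist x E powr - \<alpha>" "1 / (1 - p)"]
      by (simp add: dist_weight_pos powr_powr)
  qed
qed

lemma cube_avg_le:
  assumes "0 < l" "0 \<le> K" "(\<integral>\<^sup>+x\<in>hcube a l. w x \<partial>lebesgue) \<le> ennreal (K * l ^ CARD('n))"
  shows "cube_avg (hcube (a :: real ^ 'n) l) w \<le> ennreal K"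
proof -
  have "cube_avg (hcube a l) w \<le> ennreal (K * l ^ CARD('n)) / ennreal (l ^ CARD('n))"
    unfolding cube_avg_def emeasure_hcube[OF assms(1)] by (rule divide_right_mono_ennreal) fact
  also have "\<dots> = ennreal K" using assms by (simp add: divide_ennreal)
  finally show ?thesis .
qed

lemma cube_avg_ge:
  assumes "0 < l" "0 \<le> K" "ennreal (K * l ^ CARD('n)) \<le> (\<integral>\<^sup>+x\<in>hcube a l. w x \<partial>lebesgue)"
  shows "ennreal K \<le> cube_avg (hcube (a :: real ^ 'n) l) w"
proof -
  have "ennreal K = ennreal (K * l ^ CARD('n)) / ennreal (l ^ CARD('n))"
    using assms by (simp add: divide_ennreal)
  also have "\<dots> \<le> cube_avg (hcube a l) w"
    unfolding cube_avg_def emeasure_hcube[OF assms(1)] by (rule divide_right_mono_ennreal) fact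
  finally show ?thesis .
qed

lemma cube_avg_leD:
  assumes "0 < l" "0 \<le> K" "cube_avg (hcube (a :: real ^ 'n) l) w \<le> ennreal K"
  shows "(\<integral>\<^sup>+x\<in>hcube a l. w x \<partial>lebesgue) \<le> ennreal (K * l ^ CARD('n))"
proof -
  let ?I = "\<integral>\<^sup>+x\<in>hcube a l. w x \<partial>lebesgue"
  have "ennreal (l ^ CARD('n)) / ennreal (l ^ CARD('n)) = 1"
    using assms(1) by (intro ennreal_divide_self) simp_all
  then have "?I = ?I / ennreal (l ^ CARD('n)) * ennreal (l ^ CARD('n))"
    by (simp only: ennreal_divide_times mult_1_right)
  also have "\<dots> \<le> ennreal K * ennreal (l ^ CARD('n))"
    using assms(3) unfolding cube_avg_def emeasure_hcube[OF assms(1)] by (rule mult_right_mono) simp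
  also have "\<dots> = ennreal (K * l ^ CARD('n))" using assms by (simp add: ennreal_mult)
  finally show ?thesis .
qed

text \<open>An essential infimum is bounded by the values on any subset of positive measure; a single
  point would not do.\<close>

lemma ess_inf_le:
  assumes D: "D \<in> sets lebesgue" "D \<subseteq> Q" "emeasure lebesgue D \<noteq> 0" and w: "\<And>x. x \<in> D \<Longrightarrow> w x \<le> b"
  shows "ess_inf Q w \<le> b"
  unfolding ess_inf_def
proof (rule Sup_least)
  fix c assume "c \<in> {c. AE x in lebesgue. x \<in> Q \<longrightarrow> c \<le> w x}"
  then have AE: "AE x in lebesgue. x \<in> Q \<longrightarrow> c \<le> w x" by simp
  show "c \<le> b"
  proof (rule ccontr)
    assume cb: "\<not> c \<le> b"
    from AE have "AE x in lebesgue. x \<notin> D"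
    proof eventually_elim
      case (elim x)
      then show ?case using cb D(2) w[of x] by (auto dest: order_trans)
    qed
    then have "emeasure lebesgue D = 0"
      using D(1) by (subst (asm) AE_iff_measurable[OF D(1)]) auto
    with D(3) show False by simp
  qed
qed

lemma ess_inf_ge: "(\<And>x. x \<in> Q \<Longrightarrow> b \<le> w x) \<Longrightarrow> b \<le> ess_inf Q w"
  unfolding ess_inf_def by (rule Sup_upper) auto

context spread_distance
begin

lemma near_maximum:
  assumes l: "0 < l"
  obtains y where "y \<in> hcube a l" "0 < infdist y E" "\<And>x. x \<in> hcube a l \<Longrightarrow> infdist x E \<le> 2 * infdist y E"
proof -
  let ?A = "(\<lambda>x. infdist x E) ` hcube a l"
  obtain z where z: "z \<in> hcube a l" "0 < infdist z E" using positive[OF l] by blast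
  have bdd: "bdd_above ?A" using infdist_hcube[OF _ z(1), of _ E] by (intro bdd_aboveI2) blast
  have ub: "infdist x E \<le> Sup ?A" if "x \<in> hcube a l" for x
    using that bdd by (intro cSup_upper) auto
  then have "Sup ?A / 2 < Sup ?A" using z ub[OF z(1)] by linarith
  then obtain y where y: "y \<in> hcube a l" "Sup ?A / 2 < infdist y E"
    using less_cSupD[of ?A "Sup ?A / 2"] z by blast
  show thesis
  proof (rule that[OF y(1)])
    show "0 < infdist y E" using y(2) ub[OF z(1)] z(2) by linarith
    show "infdist x E \<le> 2 * infdist y E" if "x \<in> hcube a l" for x
      using ub[OF that] y(2) by linarith
  qed
qed

lemma superlevel_pos_measure:
  assumes "0 < l" "y \<in> hcube a l"
  shows "emeasure lebesgue {x \<in> hcube a l. \<delta> * infdist y E \<le> infdist x E} \<ge> ennreal (c * l ^ CARD('n))"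
  using spread[OF assms] emeasure_eq_measure2[OF superlevel_lmeasurable[OF assms(1), of a "\<delta> * infdist y E" E]]
  by (simp only: ennreal_leI)

text \<open>For a nonnegative power of the distance, the part of the cube given by spread already
  contributes a fixed proportion of the value at \<open>y\<close>.\<close>

lemma cube_avg_lower:
  assumes l: "0 < l" and y: "y \<in> hcube a l" and d: "0 < infdist y E" and \<beta>: "\<beta> \<le> 0"
  shows "ennreal (c * (\<delta> * infdist y E) powr - \<beta>) \<le> cube_avg (hcube a l) (dist_weight E \<beta>)"
proof (rule cube_avg_ge[OF l])
  let ?D = "{x \<in> hcube a l. \<delta> * infdist y E \<le> infdist x E}"
  let ?m = "(\<delta> * infdist y E) powr - \<beta>"
  have "ennreal (c * ?m * l ^ CARD('n)) = ennreal ?m * ennreal (c * l ^ CARD('n))"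
    using c l by (simp add: ennreal_mult[symmetric] mult_ac)
  also have "\<dots> \<le> ennreal ?m * emeasure lebesgue ?D"
    by (intro mult_left_mono superlevel_pos_measure l y) simp
  also have "\<dots> = (\<integral>\<^sup>+x. ennreal ?m * indicator ?D x \<partial>lebesgue)"
    by (rule nn_integral_cmult_indicator[symmetric, OF superlevel_measurable])
  also have "\<dots> \<le> (\<integral>\<^sup>+x\<in>hcube a l. dist_weight E \<beta> x \<partial>lebesgue)"
  proof (rule nn_integral_mono)
    fix x
    show "ennreal ?m * indicator ?D x \<le> dist_weight E \<beta> x * indicator (hcube a l) x"
    proof (cases "x \<in> ?D")
      case True
      have "0 < \<delta> * infdist y E" using d \<delta> by simp
      then have x: "0 < infdist x E" using True by auto
      have "?m \<le> infdist x E powr - \<beta>" using True \<beta> d \<delta> by (intro powr_mono2) auto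
      then show ?thesis using x True by (simp add: dist_weight_pos ennreal_leI)
    qed simp
  qed
  finally show "ennreal (c * ?m * l ^ CARD('n)) \<le> (\<integral>\<^sup>+x\<in>hcube a l. dist_weight E \<beta> x \<partial>lebesgue)" .
qed (use c in simp)

text \<open>For positive \<open>\<beta>\<close> this is the weight bound. For \<open>\<beta> \<le> 0\<close> the weight is largest where the distance is, so it
  is bounded by a multiple of its value at a near maximum. Treating both signs at once lets the same estimate serve
  for a weight and for its dual.\<close>

lemma cube_avg_upper:
  assumes "ereal \<beta> < Mu E"
  obtains K where "0 < K" "\<And>a l y. 0 < l \<Longrightarrow> y \<in> hcube a l \<Longrightarrow> 0 < infdist y E \<Longrightarrow>
      (\<And>x. x \<in> hcube a l \<Longrightarrow> infdist x E \<le> 2 * infdist y E) \<Longrightarrow>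
      cube_avg (hcube a l) (dist_weight E \<beta>) \<le> ennreal (K * infdist y E powr - \<beta>)"
proof (cases "0 < \<beta>")
  case True
  then obtain C where C: "0 < C" "\<And>a l y. 0 < l \<Longrightarrow> y \<in> hcube a l \<Longrightarrow> 0 < infdist y E \<Longrightarrow>
     (\<integral>\<^sup>+x\<in>hcube a l. dist_weight E \<beta> x \<partial>lebesgue) \<le> ennreal (C * infdist y E powr - \<beta> * l ^ CARD('n))"
    using less_Mu_imp_weight_bound[OF True assms] unfolding weight_bound_def by blast
  show thesis
  proof (rule that[OF C(1)])
    fix a y :: "real ^ 'n" and l :: real
    assume "0 < l" "y \<in> hcube a l" "0 < infdist y E"
    then show "cube_avg (hcube a l) (dist_weight E \<beta>) \<le> ennreal (C * infdist y E powr - \<beta>)"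
      using C by (intro cube_avg_le) auto
  qed
next
  case False
  show thesis
  proof (rule that[of "2 powr - \<beta>"])
    fix a y :: "real ^ 'n" and l :: real
    assume l: "0 < l" and y: "y \<in> hcube a l" "0 < infdist y E"
      and near: "\<And>x. x \<in> hcube a l \<Longrightarrow> infdist x E \<le> 2 * infdist y E"
    let ?m = "2 powr - \<beta> * infdist y E powr - \<beta>"
    have m: "?m = (2 * infdist y E) powr - \<beta>" using y by (simp add: powr_mult)
    have w: "dist_weight E \<beta> x \<le> ennreal ?m" if x: "x \<in> hcube a l" for x
    proof (cases "\<beta> = 0")
      case True
      then show ?thesis using y by (simp add: dist_weight_cases)
    next
      case nz: False
      show ?thesis
      proof (cases "infdist x E = 0")
        case True
        then show ?thesis using False nz by (simp add: dist_weight_cases)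
      next
        case pos: False
        have "infdist x E powr - \<beta> \<le> (2 * infdist y E) powr - \<beta>"
          using near[OF x] False by (intro powr_mono2) (auto simp: infdist_nonneg)
        then show ?thesis unfolding m using nz pos by (simp add: dist_weight_cases ennreal_leI)
      qed
    qed
    show "cube_avg (hcube a l) (dist_weight E \<beta>) \<le> ennreal ?m"
    proof (rule cube_avg_le[OF l])
      have "(\<integral>\<^sup>+x\<in>hcube a l. dist_weight E \<beta> x \<partial>lebesgue)
          \<le> (\<integral>\<^sup>+x. ennreal ?m * indicator (hcube a l) x \<partial>lebesgue)"
        by (rule nn_integral_mono) (auto simp: indicator_def w)
      also have "\<dots> = ennreal ?m * ennreal (l ^ CARD('n))"
        by (simp only: nn_integral_cmult_indicator[OF hcube_lebesgue] emeasure_hcube[OF l])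
      also have "\<dots> = ennreal (?m * l ^ CARD('n))" using l by (intro ennreal_mult[symmetric]) auto
      finally show "(\<integral>\<^sup>+x\<in>hcube a l. dist_weight E \<beta> x \<partial>lebesgue) \<le> ennreal (?m * l ^ CARD('n))" .
    qed simp
  qed simp
qed

lemma is_weight_dist_weight:
  assumes "ereal \<beta> < Mu E"
  shows "is_weight (dist_weight E \<beta>)"
  unfolding is_weight_def
proof (intro conjI allI impI dist_weight_measurable)
  show "AE x in lebesgue. 0 < dist_weight E \<beta> x"
    using AE_infdist_pos by eventually_elim (simp add: dist_weight_pos)
  fix K :: "(real ^ 'n) set" assume "compact K"
  then obtain r where r: "0 < r" "K \<subseteq> ball 0 r"
    using bounded_subset_ballD[OF compact_imp_bounded, of K 0] by blast
  let ?a = "\<chi> i. - r :: real ^ 'n"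
  have sub: "K \<subseteq> hcube ?a (2 * r)" using r(2) ball_subset_hcube[of "0 :: real ^ 'n" r] by auto
  have l: "0 < 2 * r" using r by simp
  obtain M where M: "0 < M" "\<And>a l y. 0 < l \<Longrightarrow> y \<in> hcube a l \<Longrightarrow> 0 < infdist y E \<Longrightarrow>
      (\<And>x. x \<in> hcube a l \<Longrightarrow> infdist x E \<le> 2 * infdist y E) \<Longrightarrow>
      cube_avg (hcube a l) (dist_weight E \<beta>) \<le> ennreal (M * infdist y E powr - \<beta>)"
    using cube_avg_upper[OF assms] by blast
  obtain y where y: "y \<in> hcube ?a (2 * r)" "0 < infdist y E"
    "\<And>x. x \<in> hcube ?a (2 * r) \<Longrightarrow> infdist x E \<le> 2 * infdist y E"
    using near_maximum[OF l] by blast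
  have "(\<integral>\<^sup>+x\<in>K. dist_weight E \<beta> x \<partial>lebesgue) \<le> (\<integral>\<^sup>+x\<in>hcube ?a (2 * r). dist_weight E \<beta> x \<partial>lebesgue)"
    using sub by (intro nn_integral_mono) (auto simp: indicator_def)
  also have "\<dots> \<le> ennreal (M * infdist y E powr - \<beta> * (2 * r) ^ CARD('n))"
    using M(1) by (intro cube_avg_leD[OF l] M(2)[OF l y]) auto
  finally show "(\<integral>\<^sup>+x\<in>K. dist_weight E \<beta> x \<partial>lebesgue) < \<infinity>"
    by (rule le_less_trans) simp
qed

text \<open>If \<open>\<alpha> < 0\<close>, the weight tends to \<open>0\<close> at a point \<open>e\<close> of \<open>E\<close>, so its essential infimum over a cube
  containing small cubes with corner \<open>e\<close> vanishes, whereas its average does not. If \<open>\<alpha> > 0\<close>, spread bounds the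
  essential infimum by a multiple of \<open>(d y)\<^sup>-\<^sup>\<alpha>\<close>, which gives the weight bound.\<close>

lemma A_one_imp_exponent:
  assumes "dist_weight E \<alpha> \<in> A_one"
  shows "0 \<le> \<alpha>" "ereal \<alpha> < Mu E"
proof -
  obtain C0 where C0: "\<And>Q. is_cube Q \<Longrightarrow> cube_avg Q (dist_weight E \<alpha>) \<le> ennreal C0 * ess_inf Q (dist_weight E \<alpha>)"
    using assms unfolding A_one_def by blast
  define C where "C = max C0 1"
  have C: "0 < C" by (simp add: C_def)
  have A1: "cube_avg (hcube a l) (dist_weight E \<alpha>) \<le> ennreal C * ess_inf (hcube a l) (dist_weight E \<alpha>)"
    if "0 < l" for a l
  proof -
    have "is_cube (hcube a l)" using that unfolding is_cube_def by blast
    from C0[OF this] show ?thesis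
      by (rule order_trans) (auto simp: C_def intro!: mult_right_mono ennreal_leI)
  qed
  show nn: "0 \<le> \<alpha>"
  proof (rule ccontr)
    assume "\<not> 0 \<le> \<alpha>"
    then have \<alpha>: "\<alpha> < 0" by simp
    let ?n = "real CARD('n)"
    have n: "0 < ?n" by simp
    obtain e where e: "e \<in> E" using nonempty by blast
    have small: "ess_inf (hcube e 1) (dist_weight E \<alpha>) \<le> 0 + ennreal t" if t: "0 < t" for t
    proof -
      define \<epsilon> where "\<epsilon> = min 1 (t powr (1 / - \<alpha>) / ?n)"
      have eps: "0 < \<epsilon>" "\<epsilon> \<le> 1" "?n * \<epsilon> \<le> t powr (1 / - \<alpha>)"
        using t n by (auto simp: \<epsilon>_def min_def field_simps)
      have "(?n * \<epsilon>) powr - \<alpha> \<le> (t powr (1 / - \<alpha>)) powr - \<alpha>"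
        using eps n \<alpha> by (intro powr_mono2) auto
      also have "\<dots> = t" using t \<alpha> by (simp add: powr_powr)
      finally have le: "(?n * \<epsilon>) powr - \<alpha> \<le> t" .
      have "ess_inf (hcube e 1) (dist_weight E \<alpha>) \<le> ennreal t"
      proof (rule ess_inf_le)
        show "hcube e \<epsilon> \<subseteq> hcube e 1"
        proof
          fix x assume x: "x \<in> hcube e \<epsilon>"
          have "e $ i \<le> x $ i \<and> x $ i < e $ i + 1" for i
          proof -
            have "e $ i \<le> x $ i" "x $ i < e $ i + \<epsilon>" using x by (auto simp: hcube_def)
            then show ?thesis using eps(2) by linarith
          qed
          then show "x \<in> hcube e 1" by (simp add: hcube_def)
        qed
        show "emeasure lebesgue (hcube e \<epsilon>) \<noteq> 0"
          unfolding emeasure_hcube[OF eps(1)] using eps by simp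
        fix x assume x: "x \<in> hcube e \<epsilon>"
        have "infdist x E \<le> ?n * \<epsilon>"
          using infdist_hcube[OF x hcube_corner[OF eps(1)], of E] e by simp
        then have "infdist x E powr - \<alpha> \<le> (?n * \<epsilon>) powr - \<alpha>"
          using \<alpha> by (intro powr_mono2) (auto simp: infdist_nonneg)
        then show "dist_weight E \<alpha> x \<le> ennreal t"
          using le \<alpha> by (auto simp: dist_weight_cases intro!: ennreal_leI)
      qed (rule hcube_lebesgue)
      then show ?thesis by simp
    qed
    have "ess_inf (hcube e 1) (dist_weight E \<alpha>) \<le> 0"
      by (rule ennreal_le_epsilon) (rule small)
    then have "ess_inf (hcube e 1) (dist_weight E \<alpha>) = 0" by simp
    then have avg: "cube_avg (hcube e 1) (dist_weight E \<alpha>) \<le> 0"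
      using A1[of 1 e] by simp
    obtain y where y: "y \<in> hcube e 1" "0 < infdist y E" using positive[of 1 e] by auto
    have "ennreal (c * (\<delta> * infdist y E) powr - \<alpha>) \<le> cube_avg (hcube e 1) (dist_weight E \<alpha>)"
      using y \<alpha> by (intro cube_avg_lower) auto
    then have "ennreal (c * (\<delta> * infdist y E) powr - \<alpha>) \<le> 0" using avg by simp
    moreover have "0 < c * (\<delta> * infdist y E) powr - \<alpha>" using c \<delta> y by simp
    ultimately show False using c(1) \<delta>(1) y(2) by auto
  qed
  show "ereal \<alpha> < Mu E"
  proof (cases "\<alpha> = 0")
    case True
    then show ?thesis using Mu_pos by (simp add: zero_ereal_def)
  next
    case False
    then have \<alpha>: "0 < \<alpha>" using nn by simp
    have "weight_bound E \<alpha>"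
      unfolding weight_bound_def
    proof (intro exI[of _ "C * \<delta> powr - \<alpha>"] conjI allI impI)
      fix a y :: "real ^ 'n" and l :: real
      assume l: "0 < l" and y: "y \<in> hcube a l" and d: "0 < infdist y E"
      let ?D = "{x \<in> hcube a l. \<delta> * infdist y E \<le> infdist x E}"
      have pos: "0 < \<delta> * infdist y E" using d \<delta> by simp
      have "ess_inf (hcube a l) (dist_weight E \<alpha>) \<le> ennreal ((\<delta> * infdist y E) powr - \<alpha>)"
      proof (rule ess_inf_le[OF superlevel_measurable])
        have "0 < c * l ^ CARD('n)" using c l by simp
        then show "emeasure lebesgue ?D \<noteq> 0" using superlevel_pos_measure[OF l y] by (auto simp: ennreal_eq_0_iff)
        fix x assume "x \<in> ?D"
        then have x: "\<delta> * infdist y E \<le> infdist x E" by simp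
        have "0 < infdist x E" using x pos by linarith
        moreover have "infdist x E powr - \<alpha> \<le> (\<delta> * infdist y E) powr - \<alpha>"
          using x pos \<alpha> by (intro powr_mono2') auto
        ultimately show "dist_weight E \<alpha> x \<le> ennreal ((\<delta> * infdist y E) powr - \<alpha>)"
          by (simp add: dist_weight_pos ennreal_leI)
      qed auto
      then have "ennreal C * ess_inf (hcube a l) (dist_weight E \<alpha>) \<le> ennreal C * ennreal ((\<delta> * infdist y E) powr - \<alpha>)"
        by (rule mult_left_mono) simp
      also have "\<dots> = ennreal (C * \<delta> powr - \<alpha> * infdist y E powr - \<alpha>)"
        using C d \<delta> by (simp add: ennreal_mult[symmetric] powr_mult mult_ac)
      finally have "cube_avg (hcube a l) (dist_weight E \<alpha>) \<le> ennreal (C * \<delta> powr - \<alpha> * infdist y E powr - \<alpha>)"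
        using A1[OF l] by (rule order_trans[rotated])
      then show "(\<integral>\<^sup>+x\<in>hcube a l. dist_weight E \<alpha> x \<partial>lebesgue)
          \<le> ennreal (C * \<delta> powr - \<alpha> * infdist y E powr - \<alpha> * l ^ CARD('n))"
        using C by (intro cube_avg_leD l) auto
    qed (use C \<delta> in simp)
    then show ?thesis by (rule weight_bound_imp_less_Mu[OF \<alpha>])
  qed
qed

lemma exponent_imp_A_one:
  assumes "0 \<le> \<alpha>" "ereal \<alpha> < Mu E"
  shows "dist_weight E \<alpha> \<in> A_one"
proof -
  obtain K where K: "0 < K" "\<And>a l y. 0 < l \<Longrightarrow> y \<in> hcube a l \<Longrightarrow> 0 < infdist y E \<Longrightarrow>
      (\<And>x. x \<in> hcube a l \<Longrightarrow> infdist x E \<le> 2 * infdist y E) \<Longrightarrow>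
      cube_avg (hcube a l) (dist_weight E \<alpha>) \<le> ennreal (K * infdist y E powr - \<alpha>)"
    using cube_avg_upper[OF assms(2)] by blast
  have "cube_avg Q (dist_weight E \<alpha>) \<le> ennreal (K * 2 powr \<alpha>) * ess_inf Q (dist_weight E \<alpha>)"
    if "is_cube Q" for Q
  proof -
    obtain a l where Q: "0 < l" "Q = hcube a l" using \<open>is_cube Q\<close> unfolding is_cube_def by blast
    obtain y where y: "y \<in> hcube a l" "0 < infdist y E"
      "\<And>x. x \<in> hcube a l \<Longrightarrow> infdist x E \<le> 2 * infdist y E"
      using near_maximum[OF Q(1)] by blast
    have inf: "ennreal ((2 * infdist y E) powr - \<alpha>) \<le> ess_inf Q (dist_weight E \<alpha>)"
    proof (rule ess_inf_ge)
      fix x assume x: "x \<in> Q"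
      consider "\<alpha> = 0" | "\<alpha> \<noteq> 0" "infdist x E = 0" | "0 < infdist x E"
        using infdist_nonneg[of x E] by linarith
      then show "ennreal ((2 * infdist y E) powr - \<alpha>) \<le> dist_weight E \<alpha> x"
      proof cases
        case 3
        have "(2 * infdist y E) powr - \<alpha> \<le> infdist x E powr - \<alpha>"
          using y(3)[of x] x Q 3 assms(1) by (intro powr_mono2') auto
        then show ?thesis using 3 by (simp add: dist_weight_pos ennreal_leI)
      qed (use assms(1) y(2) in \<open>simp_all add: dist_weight_cases\<close>)
    qed
    have "cube_avg Q (dist_weight E \<alpha>) \<le> ennreal (K * infdist y E powr - \<alpha>)"
      unfolding Q(2) by (rule K(2)[OF Q(1) y])
    also have "K * infdist y E powr - \<alpha> = K * 2 powr \<alpha> * (2 * infdist y E) powr - \<alpha>"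
      using y(2) by (simp add: powr_mult powr_minus)
    also have "ennreal \<dots> = ennreal (K * 2 powr \<alpha>) * ennreal ((2 * infdist y E) powr - \<alpha>)"
      using K(1) by (intro ennreal_mult) auto
    also have "\<dots> \<le> ennreal (K * 2 powr \<alpha>) * ess_inf Q (dist_weight E \<alpha>)"
      by (intro mult_left_mono inf) simp
    finally show ?thesis .
  qed
  then show ?thesis unfolding A_one_def using is_weight_dist_weight[OF assms(2)] by blast
qed

lemma A_class_iff_dual:
  assumes "1 < p"
  shows "dist_weight E \<alpha> \<in> A_class p \<longleftrightarrow> is_weight (dist_weight E \<alpha>) \<and>
    (\<exists>C. \<forall>Q. is_cube Q \<longrightarrow>
      cube_avg Q (dist_weight E \<alpha>) * epow (cube_avg Q (dist_weight E (\<alpha> / (1 - p)))) (p - 1) \<le> ennreal C)"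
  unfolding A_class_def mem_Collect_eq dual_dist_weight[OF assms] ..

text \<open>At most one of the exponents \<open>\<alpha>\<close> and \<open>\<alpha> / (1 - p)\<close> is positive; the other weight is then a
  nonnegative power of the distance, and the lower bound for its average turns the \<open>A\<^sub>p\<close> condition
  into the weight bound for the first. For nonpositive exponents \<open>Mu E > 0\<close> is enough.\<close>

lemma A_class_imp_exponents:
  assumes p: "1 < p" and A: "dist_weight E \<alpha> \<in> A_class p"
  shows "ereal \<alpha> < Mu E" "ereal (\<alpha> / (1 - p)) < Mu E"
proof -
  let ?\<alpha>' = "\<alpha> / (1 - p)"
  obtain C0 where C0: "\<And>Q. is_cube Q \<Longrightarrow>
      cube_avg Q (dist_weight E \<alpha>) * epow (cube_avg Q (dist_weight E ?\<alpha>')) (p - 1) \<le> ennreal C0"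
    using A unfolding A_class_iff_dual[OF p] by blast
  define C where "C = max C0 1"
  have C: "0 < C" by (simp add: C_def)
  have Ap: "cube_avg (hcube a l) (dist_weight E \<alpha>) * epow (cube_avg (hcube a l) (dist_weight E ?\<alpha>')) (p - 1) \<le> ennreal C"
    if "0 < l" for a l
  proof -
    have "is_cube (hcube a l)" using that unfolding is_cube_def by blast
    from C0[OF this] show ?thesis
      by (rule order_trans) (auto simp: C_def intro!: ennreal_leI)
  qed
  have pa: "?\<alpha>' * (p - 1) = - \<alpha>" using p by (simp add: field_simps)
  have quot: "x \<le> ennreal (b / m)" if "ennreal m * x \<le> ennreal b" "0 < m" "0 < b" for x m b
  proof (cases x)
    case (real r)
    then have "ennreal (m * r) \<le> ennreal b" using that by (simp add: ennreal_mult)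
    then have "m * r \<le> b" using that by simp
    then show ?thesis using that real by (simp add: field_simps ennreal_leI)
  next
    case top
    then show ?thesis using that by (simp add: ennreal_mult_top top_unique)
  qed
  show "ereal \<alpha> < Mu E"
  proof (cases "0 < \<alpha>")
    case False
    then have "ereal \<alpha> \<le> 0" by simp
    then show ?thesis using Mu_pos by (rule le_less_trans)
  next
    case True
    then have neg: "?\<alpha>' \<le> 0" using p by (simp add: divide_nonneg_neg)
    define C1 where "C1 = C / (c powr (p - 1) * \<delta> powr \<alpha>)"
    have C1: "0 < C1" using C c \<delta> by (simp add: C1_def)
    have "weight_bound E \<alpha>"
      unfolding weight_bound_def
    proof (intro exI[of _ C1] conjI allI impI C1)
      fix a y :: "real ^ 'n" and l :: real
      assume l: "0 < l" and y: "y \<in> hcube a l" and d: "0 < infdist y E"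
      let ?m = "c * (\<delta> * infdist y E) powr - ?\<alpha>'"
      have m: "0 < ?m" using c \<delta> d by simp
      have mp: "?m powr (p - 1) = c powr (p - 1) * \<delta> powr \<alpha> * infdist y E powr \<alpha>"
        using c \<delta> d pa by (simp add: powr_mult powr_powr)
      have "epow (ennreal ?m) (p - 1) \<le> epow (cube_avg (hcube a l) (dist_weight E ?\<alpha>')) (p - 1)"
        using p by (intro epow_mono cube_avg_lower l y d neg) auto
      then have "ennreal (?m powr (p - 1)) * cube_avg (hcube a l) (dist_weight E \<alpha>)
          \<le> epow (cube_avg (hcube a l) (dist_weight E ?\<alpha>')) (p - 1) * cube_avg (hcube a l) (dist_weight E \<alpha>)"
        unfolding epow_ennreal[OF m] by (rule mult_right_mono) simp
      also have "\<dots> \<le> ennreal C" using Ap[OF l, of a] by (simp add: mult.commute)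
      finally have "cube_avg (hcube a l) (dist_weight E \<alpha>) \<le> ennreal (C / ?m powr (p - 1))"
        using m C by (intro quot) auto
      also have "C / ?m powr (p - 1) = C1 * infdist y E powr - \<alpha>"
        unfolding mp by (simp add: C1_def powr_minus field_simps)
      finally show "(\<integral>\<^sup>+x\<in>hcube a l. dist_weight E \<alpha> x \<partial>lebesgue)
          \<le> ennreal (C1 * infdist y E powr - \<alpha> * l ^ CARD('n))"
        using C1 by (intro cube_avg_leD l) auto
    qed
    then show ?thesis by (rule weight_bound_imp_less_Mu[OF True])
  qed
  show "ereal ?\<alpha>' < Mu E"
  proof (cases "0 < ?\<alpha>'")
    case False
    then have "ereal ?\<alpha>' \<le> 0" by simp
    then show ?thesis using Mu_pos by (rule le_less_trans)
  next
    case True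
    then have neg: "\<alpha> \<le> 0" using p by (simp add: zero_less_divide_iff)
    define C1 where "C1 = (C / (c * \<delta> powr - \<alpha>)) powr (1 / (p - 1))"
    have C1: "0 < C1" using C c \<delta> by (simp add: C1_def)
    have "weight_bound E ?\<alpha>'"
      unfolding weight_bound_def
    proof (intro exI[of _ C1] conjI allI impI C1)
      fix a y :: "real ^ 'n" and l :: real
      assume l: "0 < l" and y: "y \<in> hcube a l" and d: "0 < infdist y E"
      let ?m = "c * (\<delta> * infdist y E) powr - \<alpha>"
      have m: "0 < ?m" using c \<delta> d by simp
      have "ennreal ?m * epow (cube_avg (hcube a l) (dist_weight E ?\<alpha>')) (p - 1)
          \<le> cube_avg (hcube a l) (dist_weight E \<alpha>) * epow (cube_avg (hcube a l) (dist_weight E ?\<alpha>')) (p - 1)"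
        by (intro mult_right_mono cube_avg_lower l y d neg) simp
      also have "\<dots> \<le> ennreal C" by (rule Ap[OF l])
      finally have "epow (cube_avg (hcube a l) (dist_weight E ?\<alpha>')) (p - 1) \<le> ennreal (C / ?m)"
        using m C by (intro quot) auto
      then have "cube_avg (hcube a l) (dist_weight E ?\<alpha>') \<le> ennreal ((C / ?m) powr (1 / (p - 1)))"
        using p m C by (intro epow_le_imp_le) auto
      also have "C / ?m = C / (c * \<delta> powr - \<alpha>) * infdist y E powr \<alpha>"
        using \<delta> d by (simp add: powr_mult powr_minus field_simps)
      also have "\<dots> powr (1 / (p - 1)) = C1 * infdist y E powr - ?\<alpha>'"
      proof -
        have "\<alpha> * (1 / (p - 1)) = - ?\<alpha>'" using p by (simp add: field_simps)
        then have "(infdist y E powr \<alpha>) powr (1 / (p - 1)) = infdist y E powr - ?\<alpha>'"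
          by (simp only: powr_powr)
        then show ?thesis unfolding C1_def by (subst powr_mult) simp_all
      qed
      finally show "(\<integral>\<^sup>+x\<in>hcube a l. dist_weight E ?\<alpha>' x \<partial>lebesgue)
          \<le> ennreal (C1 * infdist y E powr - ?\<alpha>' * l ^ CARD('n))"
        using C1 by (intro cube_avg_leD l) auto
    qed
    then show ?thesis by (rule weight_bound_imp_less_Mu[OF True])
  qed
qed

text \<open>At a near maximum \<open>y\<close> of the distance both averages are bounded by powers of \<open>d y\<close>, and these cancel since
  \<open>\<alpha> / (1 - p) * (p - 1) = - \<alpha>\<close>.\<close>

lemma exponents_imp_A_class:
  assumes p: "1 < p" and "ereal \<alpha> < Mu E" "ereal (\<alpha> / (1 - p)) < Mu E"
  shows "dist_weight E \<alpha> \<in> A_class p"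
proof -
  let ?\<alpha>' = "\<alpha> / (1 - p)"
  obtain K where K: "0 < K" "\<And>a l y. 0 < l \<Longrightarrow> y \<in> hcube a l \<Longrightarrow> 0 < infdist y E \<Longrightarrow>
      (\<And>x. x \<in> hcube a l \<Longrightarrow> infdist x E \<le> 2 * infdist y E) \<Longrightarrow>
      cube_avg (hcube a l) (dist_weight E \<alpha>) \<le> ennreal (K * infdist y E powr - \<alpha>)"
    using cube_avg_upper[OF assms(2)] by blast
  obtain K' where K': "0 < K'" "\<And>a l y. 0 < l \<Longrightarrow> y \<in> hcube a l \<Longrightarrow> 0 < infdist y E \<Longrightarrow>
      (\<And>x. x \<in> hcube a l \<Longrightarrow> infdist x E \<le> 2 * infdist y E) \<Longrightarrow>
      cube_avg (hcube a l) (dist_weight E ?\<alpha>') \<le> ennreal (K' * infdist y E powr - ?\<alpha>')"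
    using cube_avg_upper[OF assms(3)] by blast
  have pa: "?\<alpha>' * (p - 1) = - \<alpha>" using p by (simp add: field_simps)
  have "cube_avg Q (dist_weight E \<alpha>) * epow (cube_avg Q (dist_weight E ?\<alpha>')) (p - 1)
      \<le> ennreal (K * K' powr (p - 1))" if "is_cube Q" for Q
  proof -
    obtain a l where Q: "0 < l" "Q = hcube a l" using \<open>is_cube Q\<close> unfolding is_cube_def by blast
    obtain y where y: "y \<in> hcube a l" "0 < infdist y E"
      "\<And>x. x \<in> hcube a l \<Longrightarrow> infdist x E \<le> 2 * infdist y E"
      using near_maximum[OF Q(1)] by blast
    have "epow (cube_avg Q (dist_weight E ?\<alpha>')) (p - 1) \<le> epow (ennreal (K' * infdist y E powr - ?\<alpha>')) (p - 1)"
      unfolding Q(2) using p by (intro epow_mono K'(2)[OF Q(1) y]) auto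
    also have "\<dots> = ennreal ((K' * infdist y E powr - ?\<alpha>') powr (p - 1))"
      using K'(1) y(2) by (intro epow_ennreal) simp
    also have "(K' * infdist y E powr - ?\<alpha>') powr (p - 1) = K' powr (p - 1) * infdist y E powr \<alpha>"
      using K'(1) y(2) pa by (simp add: powr_mult powr_powr)
    finally have "cube_avg Q (dist_weight E \<alpha>) * epow (cube_avg Q (dist_weight E ?\<alpha>')) (p - 1)
        \<le> ennreal (K * infdist y E powr - \<alpha>) * ennreal (K' powr (p - 1) * infdist y E powr \<alpha>)"
      using K(2)[OF Q(1) y] unfolding Q(2) by (intro mult_mono) auto
    also have "\<dots> = ennreal (K * K' powr (p - 1))"
      using K(1) K'(1) y(2) by (simp add: ennreal_mult[symmetric] powr_minus)
    finally show ?thesis .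
  qed
  then show ?thesis unfolding A_class_iff_dual[OF p] using is_weight_dist_weight[OF assms(2)] by blast
qed

end

section \<open>The characterisation\<close>

lemma ereal_mult_less_iff_divide:
  assumes "1 < p"
  shows "ereal (1 - p) * M < ereal \<alpha> \<longleftrightarrow> ereal (\<alpha> / (1 - p)) < M"
proof (cases M)
  case (real r)
  have "(1 - p) * r < \<alpha> \<longleftrightarrow> \<alpha> / (1 - p) < r"
    using assms by (simp add: neg_divide_less_eq mult.commute)
  with real show ?thesis by simp
qed (use assms in auto)

theorem theorem1p2:
  fixes E :: "(real ^ 'n) set" and \<alpha> :: real
  assumes "weakly_porous E"
  shows "(dist_weight E \<alpha> \<in> A_one \<longleftrightarrow> 0 \<le> \<alpha> \<and> ereal \<alpha> < Mu E) \<and>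
         (\<forall>p::real. 1 < p \<longrightarrow>
            (dist_weight E \<alpha> \<in> A_class p \<longleftrightarrow> ereal (1 - p) * Mu E < ereal \<alpha> \<and> ereal \<alpha> < Mu E))"
proof -
  obtain c \<delta> where "0 < c" "c < 1" "0 < \<delta>" "\<delta> < 1"
    "\<And>a l y. 0 < l \<Longrightarrow> y \<in> hcube a l \<Longrightarrow>
       c * l ^ CARD('n) \<le> measure lebesgue {x \<in> hcube a l. \<delta> * infdist y E \<le> infdist x E}"
    "\<And>a l. 0 < l \<Longrightarrow> \<exists>y\<in>hcube a l. 0 < infdist y E"
    using weakly_porous_spread[OF assms] by blast
  moreover have "E \<noteq> {}" using assms by (simp add: weakly_porous_def)
  ultimately interpret spread_distance E c \<delta> by unfold_locales
  show ?thesis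
    using A_one_imp_exponent exponent_imp_A_one A_class_imp_exponents exponents_imp_A_class ereal_mult_less_iff_divide by blast
qed

end
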